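(* (Revolving Door Criterion.) Consider a (well-posed) Linear Dynamic Influence Model (LDIM) $(Q(\mathbf z),e)$ with output $(y_i,y_j,y_k,y_s)$ admitting as graphical representation the directed graph $G$ on the nodes $y_i,y_j,y_k,y_s$ whose edges are exactly $y_i\to y_j$, $y_j\to y_k$, $y_k\to y_i$, $y_s\to y_i$, $y_s\to y_j$, $y_s\to y_k$. Assume that the power spectral density of $(y_i,y_j,y_k,y_s)$ is positive definite at every point of the unit circle. Then the following implicit relation for the transfer function $Q_{ji}(\mathbf z)$ holds: $$\begin{aligned}Q_{ji}=\Big\{\mathcal I&-W_{j,[k]|i,k,s}\,W_{k,[j]|j,i,s}\\&-W_{j,[k]|i,k,s}\,W_{k,[i]|j,i,s}\,\big(\mathcal I-W_{i,[j]|k,j,s}\,Q_{ji}-W_{i,[k]|k,j,s}\,W_{k,[i]|j,i,s}\big)^{-1}\,W_{i,[k]|k,j,s}\,W_{k,[j]|j,i,s}\Big\}^{-1}W_{j,[i]|i,k,s},\end{aligned}$$ where, for nodes $a,b,c\in\{i,j,k\}$, $W_{a,[b]|b,c,s}$ denotes the component acting on $y_b$ of the non-causal Wiener filter estimating $y_a$ from $(y_b,y_c,y_s)$.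
   Context: **Transfer functions.** $\mathcal F$ is the set of real-rational transfer functions with no poles on the unit circle $|\mathbf z|=1$ (the zero function is allowed). Each $P\in\mathcal F$ has a unique bi-infinite expansion $P(\mathbf z)=\sum_{k\in\mathbb Z}p_k\mathbf z^{-k}$ for $|\mathbf z|=1$; $P$ is causal if $p_k=0$ for $k<0$, and $\mathcal F^+$ is the set of causal elements. For matrices these notions are entrywise. $P(\mathbf z)u$ denotes the process $t\mapsto\sum_k p_{t-k}u(k)$. **LDIM.** A pair $(Q(\mathbf z),e)$, where $Q$ is an $n\times n$ block matrix with entries in $\mathcal F$ and $e=(e_1^T,\dots,e_n^T)^T$ is a zero-mean wide-sense stationary vector process of the form $e=P(\mathbf z)u$, with $P$ block diagonal with entries in $\mathcal F^+$ and $\Phi_u(\mathbf z)=\mathcal I$; in particular the power spectral density $\Phi_e$ is rational and block diagonal. The output $y$ satisfies $y=Q(\mathbf z)y+e$. For index sets $A,B$, $Q_{AB}$ is the submatrix with row blocks $A$ and column blocks $B$; $Q_{ba}$ is the block from $y_a$ to $y_b$. The LDIM is well-posed if for every set $A$ of indices the matrix $\mathcal I-Q_{AA}(\mathbf z)$ is invertible with inverse having no poles on the unit circle; then $y=(\mathcal I-Q)^{-1}e$ is wide-sense stationary. **Graphical representation.** A directed graph $G=(V,\vec E)$ whose vertices are the output nodes and such that $(y_a,y_b)\notin\vec E$ implies $Q_{ba}(\mathbf z)=0$ (edges may correspond to zero transfer functions). **Wiener filter.** For jointly stationary zero-mean processes with rational spectra, $\mathrm{tfspan}\{y_A\}$ is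 the set of processes $\sum_{a\in A}P_a(\mathbf z)y_a$ with entries of $P_a$ in $\mathcal F$. The non-causal Wiener estimate of $x$ from $y_A$ is the minimizer $W_{x|y_A}(\mathbf z)y_A$ of $\mathbf E[(x-q)^T(x-q)]$ over $q\in\mathrm{tfspan}\{y_A\}$; when $\Phi_{y_A}\succ0$ on the unit circle the filter $W_{x|y_A}$ is unique. The block of $W_{x|y_A}$ multiplying $y_a$ is the component acting on $y_a$. *)

theory Defs
  imports
    "HOL-Probability.Probability"
    "HOL-Computational_Algebra.Polynomial_Factorial"
    "HOL-Computational_Algebra.Field_as_Ring"
begin

section \<open>Transfer functions\<close>

text \<open>
  A real-rational function of the variable \<open>z\<close> is an element of the field of fractions of
  \<open>\<real>[z]\<close>. In the reduced representation \<^const>\<open>quot_of_fract\<close> the numerator and the denominator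
  are coprime over the reals, hence have no common complex root; so the poles are exactly the
  complex roots of the reduced denominator.
\<close>

type_synonym tf = "real poly fract"

definition tf_num :: "tf \<Rightarrow> complex \<Rightarrow> complex" where
  "tf_num r z = poly (map_poly complex_of_real (fst (quot_of_fract r))) z"

definition tf_den :: "tf \<Rightarrow> complex \<Rightarrow> complex" where
  "tf_den r z = poly (map_poly complex_of_real (snd (quot_of_fract r))) z"

definition tf_eval :: "tf \<Rightarrow> complex \<Rightarrow> complex" where
  "tf_eval r z = tf_num r z / tf_den r z"

definition tf_F :: "tf set" where
  "tf_F = {r. \<forall>z. cmod z = 1 \<longrightarrow> tf_den r z \<noteq> 0}"

text \<open>
  The bi-infinite expansion \<open>r(z) = \<Sum>k. p k * z^(-k)\<close> on the unit circle; it exists, is unique and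
  has real coefficients for \<open>r \<in> tf_F\<close> (and only such \<open>r\<close> are used below).
\<close>

definition tf_coeff :: "tf \<Rightarrow> int \<Rightarrow> real" where
  "tf_coeff r = (THE p. \<forall>z. cmod z = 1 \<longrightarrow>
     ((\<lambda>k. complex_of_real (p k) * z powi (- k)) has_sum tf_eval r z) UNIV)"

definition tf_F_causal :: "tf set" where
  "tf_F_causal = {r \<in> tf_F. \<forall>k<0. tf_coeff r k = 0}"

definition entries_in :: "'t set \<Rightarrow> 't ^ 'b::finite ^ 'a::finite \<Rightarrow> bool" where
  "entries_in S A \<longleftrightarrow> (\<forall>a b. A $ a $ b \<in> S)"

definition submat :: "('c::finite \<Rightarrow> 'a::finite) \<Rightarrow> ('d::finite \<Rightarrow> 'b::finite) \<Rightarrow> 't ^ 'b ^ 'a \<Rightarrow> 't ^ 'd ^ 'c" where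
  "submat f g A = (\<chi> i j. A $ f i $ g j)"


section \<open>Stationary processes\<close>

type_synonym ('w, 'a) process = "int \<Rightarrow> 'w \<Rightarrow> real ^ 'a"

definition stack :: "('w, 'a::finite) process \<Rightarrow> ('w, 'b::finite) process \<Rightarrow> ('w, 'a + 'b) process"
    (infixr \<open>\<oplus>\<close> 65) where
  "x \<oplus> y = (\<lambda>t \<omega>. \<chi> c. case c of Inl a \<Rightarrow> x t \<omega> $ a | Inr b \<Rightarrow> y t \<omega> $ b)"

definition zero_mean_wss :: "'w measure \<Rightarrow> ('w, 'a::finite) process \<Rightarrow> bool" where
  "zero_mean_wss M x \<longleftrightarrow>
     (\<forall>t a. (\<lambda>\<omega>. x t \<omega> $ a) \<in> borel_measurable M \<and>
            integrable M (\<lambda>\<omega>. (x t \<omega> $ a)\<^sup>2) \<and>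
            integral\<^sup>L M (\<lambda>\<omega>. x t \<omega> $ a) = 0) \<and>
     (\<forall>t k a b. integral\<^sup>L M (\<lambda>\<omega>. x (t + k) \<omega> $ a * x t \<omega> $ b) =
                integral\<^sup>L M (\<lambda>\<omega>. x k \<omega> $ a * x 0 \<omega> $ b))"

definition autocorr :: "'w measure \<Rightarrow> ('w, 'a::finite) process \<Rightarrow> int \<Rightarrow> real ^ 'a ^ 'a" where
  "autocorr M x k = (\<chi> a b. integral\<^sup>L M (\<lambda>\<omega>. x k \<omega> $ a * x 0 \<omega> $ b))"

text \<open>
  The power spectral density is stated as a relation: a total function based on \<^const>\<open>infsum\<close>
  would give the value 0 to entries whose defining series does not converge.
\<close>

definition has_psd ::
    "'w measure \<Rightarrow> ('w, 'a::finite) process \<Rightarrow> (complex \<Rightarrow> complex ^ 'a ^ 'a) \<Rightarrow> bool" where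
  "has_psd M x \<Phi> \<longleftrightarrow> (\<forall>z a b. cmod z = 1 \<longrightarrow>
     ((\<lambda>k. complex_of_real (autocorr M x k $ a $ b) * z powi (- k)) has_sum \<Phi> z $ a $ b) UNIV)"

definition hermitian_pos_def :: "complex ^ 'a ^ 'a::finite \<Rightarrow> bool" where
  "hermitian_pos_def A \<longleftrightarrow>
     (\<forall>a b. A $ a $ b = cnj (A $ b $ a)) \<and>
     (\<forall>v. v \<noteq> 0 \<longrightarrow> 0 < Re (\<Sum>a\<in>UNIV. \<Sum>b\<in>UNIV. cnj (v $ a) * A $ a $ b * v $ b))"

text \<open>
  The process \<open>P(z) x\<close>. For \<open>P\<close> with entries in \<^const>\<open>tf_F\<close> and \<open>x\<close> wide-sense stationary the
  coefficients are absolutely summable and \<open>E \<bar>x k\<bar>\<close> is bounded, so each series converges absolutely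
  almost surely, and its sum agrees almost surely with its mean-square limit.
\<close>

definition tf_apply :: "tf ^ 'b ^ 'a::finite \<Rightarrow> ('w, 'b::finite) process \<Rightarrow> ('w, 'a) process" where
  "tf_apply P x = (\<lambda>t \<omega>. \<chi> a. \<Sum>b\<in>UNIV. \<Sum>\<^sub>\<infinity>k. tf_coeff (P $ a $ b) (t - k) * x k \<omega> $ b)"

definition proc_eq :: "'w measure \<Rightarrow> ('w, 'a::finite) process \<Rightarrow> ('w, 'a) process \<Rightarrow> bool" where
  "proc_eq M x y \<longleftrightarrow> (\<forall>t. AE \<omega> in M. x t \<omega> = y t \<omega>)"


section \<open>Linear dynamic influence models\<close>

text \<open>
  Block structure is encoded by a map from scalar coordinates to nodes: for \<open>nd :: 'c \<Rightarrow> 'v\<close>, the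
  block of node \<open>v\<close> consists of the coordinates in \<open>nd -` {v}\<close>. Blocks of different nodes may have
  different dimensions. The driving noise \<open>u\<close> has its own coordinates and block map \<open>nu\<close>, so the
  diagonal blocks of \<open>P\<close> need not be square.
\<close>

definition ldim ::
    "'w measure \<Rightarrow> ('c::finite \<Rightarrow> 'v) \<Rightarrow> tf ^ 'c ^ 'c \<Rightarrow>
     ('d::finite \<Rightarrow> 'v) \<Rightarrow> tf ^ 'd ^ 'c \<Rightarrow> ('w, 'd) process \<Rightarrow> ('w, 'c) process \<Rightarrow> bool" where
  "ldim M nd Q nu P u e \<longleftrightarrow>
     prob_space M \<and>
     entries_in tf_F Q \<and>
     entries_in tf_F_causal P \<and>
     (\<forall>a b. nd a \<noteq> nu b \<longrightarrow> P $ a $ b = 0) \<and>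
     zero_mean_wss M u \<and>
     has_psd M u (\<lambda>z. mat 1) \<and>
     zero_mean_wss M e \<and>
     proc_eq M e (tf_apply P u)"

text \<open>
  The equation \<open>y = Q(z) y + e\<close> is understood for wide-sense stationary \<open>y\<close>; in a well-posed model
  its unique such solution is \<open>(I - Q(z))\<^sup>-\<^sup>1 e\<close>.
\<close>

definition ldim_output ::
    "'w measure \<Rightarrow> tf ^ 'c ^ 'c \<Rightarrow> ('w, 'c::finite) process \<Rightarrow> ('w, 'c) process \<Rightarrow> bool" where
  "ldim_output M Q e y \<longleftrightarrow>
     zero_mean_wss M y \<and> proc_eq M y (\<lambda>t \<omega>. tf_apply Q y t \<omega> + e t \<omega>)"

text \<open>
  \<open>R\<close> is a two-sided inverse of \<open>I - Q\<^sub>A\<^sub>A\<close>; only its entries with both coordinates in blocks of \<open>A\<close>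
  are relevant.
\<close>

definition well_posed :: "('c::finite \<Rightarrow> 'v) \<Rightarrow> tf ^ 'c ^ 'c \<Rightarrow> bool" where
  "well_posed nd Q \<longleftrightarrow> (\<forall>A :: 'v set. \<exists>R :: 'c \<Rightarrow> 'c \<Rightarrow> tf.
     \<forall>a \<in> nd -` A. \<forall>b \<in> nd -` A.
       R a b \<in> tf_F \<and>
       (\<Sum>c \<in> nd -` A. (mat 1 - Q) $ a $ c * R c b) = (if a = b then 1 else 0) \<and>
       (\<Sum>c \<in> nd -` A. R a c * (mat 1 - Q) $ c $ b) = (if a = b then 1 else 0))"

text \<open>An edge \<open>(v, w)\<close> points from \<open>v\<close> to \<open>w\<close> and concerns the block \<open>Q\<^sub>w\<^sub>v\<close>.\<close>

definition graphical_representation ::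
    "('c::finite \<Rightarrow> 'v) \<Rightarrow> tf ^ 'c ^ 'c \<Rightarrow> ('v \<times> 'v) set \<Rightarrow> bool" where
  "graphical_representation nd Q E \<longleftrightarrow>
     (\<forall>v w. (v, w) \<notin> E \<longrightarrow> (\<forall>a b. nd a = w \<longrightarrow> nd b = v \<longrightarrow> Q $ a $ b = 0))"


section \<open>Non-causal Wiener filter\<close>

definition tfspan :: "('w, 'b::finite) process \<Rightarrow> ('w, 'a::finite) process set" where
  "tfspan y = {tf_apply P y | P. entries_in tf_F P}"

text \<open>
  The cost is taken at time 0; for jointly stationary processes it does not depend on the time.
\<close>

definition wiener_filter ::
    "'w measure \<Rightarrow> ('w, 'a::finite) process \<Rightarrow> ('w, 'b::finite) process \<Rightarrow> tf ^ 'b ^ 'a \<Rightarrow> bool" where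
  "wiener_filter M x y W \<longleftrightarrow>
     entries_in tf_F W \<and>
     is_arg_min (\<lambda>q. integral\<^sup>L M (\<lambda>\<omega>. (x 0 \<omega> - q 0 \<omega>) \<bullet> (x 0 \<omega> - q 0 \<omega>)))
       (\<lambda>q. q \<in> tfspan y) (tf_apply W y)"


section \<open>The revolving door graph\<close>

datatype node = Ni | Nj | Nk | Ns

definition node_of :: "'i + 'j + 'k + 's \<Rightarrow> node" where
  "node_of = case_sum (\<lambda>_. Ni) (case_sum (\<lambda>_. Nj) (case_sum (\<lambda>_. Nk) (\<lambda>_. Ns)))"

definition revolving_door :: "(node \<times> node) set" where
  "revolving_door = {(Ni, Nj), (Nj, Nk), (Nk, Ni), (Ns, Ni), (Ns, Nj), (Ns, Nk)}"

abbreviation first :: "'a \<Rightarrow> 'a + 'b" where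
  "first \<equiv> Inl"

abbreviation second :: "'b \<Rightarrow> 'a + 'b + 'c" where
  "second \<equiv> \<lambda>b. Inr (Inl b)"

end

(*
The joint spectral density is Phi = (I - Q)^-1 Psi (I - Q)^-* with Psi block diagonal, because
different nodes are driven by uncorrelated blocks of white noise. Orthogonality of the estimation
errors says that the row v = (I, -W) belonging to the node a satisfies "v Phi is supported on the
block a". Writing v = w (I - Q), w Psi is then supported on a and its only child b, hence so is w.
Comparing the coordinates of v = w (I - Q) at a, at b and at the parent c of a that does not precede
b gives, with L_a = I - W_{a,[b]} Q_ba,

  W_{a,[c]} = L_a Q_ac,

and positive definiteness makes L_a invertible. The three instances of this identity around the
cycle, together with the invertibility of I - Q_ik W_{k,[i]} (equivalent to that of L_k), yield
N^-1 W_{i,[k]} W_{k,[j]} = Q_ik Q_kj, so that the expression in braces collapses to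
L_j = I - W_{j,[k]} Q_kj, and L_j Q_ji = W_{j,[i]}.
*)

theory Submission
  imports Defs "HOL-Computational_Algebra.Fundamental_Theorem_Algebra"
begin

section \<open>Evaluation of transfer functions\<close>

text \<open>The spectral density enters as a relation: what is known are its values on the unit
  circle, sums of covariance series. The argument with rows is therefore carried out for complex
  matrices at one fixed point of the circle, and an identity of transfer functions is recovered
  because elements of \<open>tf_F\<close> agree as soon as their values on the infinite circle do.
  Between expectations and spectra stands the uniqueness of absolutely convergent Fourier series,
  which also gives a meaning to the definite description \<open>tf_coeff\<close>; it is obtained by
  averaging over roots of unity, without integration.

  Blocks have arbitrary sizes, so the identity for W is tested against every row x: then (x, -xW) is
  a single vector v, and x L_a is the part of w on the block a. If x L_a = 0, positive definiteness
  forces v = 0, hence x = 0.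

  Psi itself is never inverted: a row whose product with Psi vanishes on one block is cut down to
  that block, and the quadratic form of Phi decides.\<close>

lemma map_poly_of_real_mult:
  "map_poly complex_of_real (p * q) = map_poly complex_of_real p * map_poly complex_of_real q"
  by (intro poly_eqI) (simp add: coeff_map_poly coeff_mult)

lemma map_poly_of_real_add:
  "map_poly complex_of_real (p + q) = map_poly complex_of_real p + map_poly complex_of_real q"
  by (intro poly_eqI) (simp add: coeff_map_poly)

definition rpoly :: "real poly \<Rightarrow> complex \<Rightarrow> complex" where
  "rpoly p z = poly (map_poly complex_of_real p) z"

lemma rpoly_simps [simp]:
  "rpoly (p + q) z = rpoly p z + rpoly q z"
  "rpoly (p * q) z = rpoly p z * rpoly q z"
  "rpoly 0 z = 0" "rpoly 1 z = 1"
  "rpoly (monom c n) z = of_real c * z ^ n"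
  by (simp_all add: rpoly_def map_poly_of_real_mult map_poly_of_real_add map_poly_monom poly_monom)

lemma rpoly_cnj: "rpoly p (cnj z) = cnj (rpoly p z)"
  unfolding rpoly_def by (rule poly_cnj_real[symmetric]) (simp add: coeff_map_poly)

lemma finite_rpoly_roots: "p \<noteq> 0 \<Longrightarrow> finite {z. rpoly p z = 0}"
  unfolding rpoly_def by (intro poly_roots_finite) (simp add: map_poly_eq_0_iff)

lemma tf_den_rpoly: "tf_den r z = rpoly (snd (quot_of_fract r)) z"
  and tf_eval_rpoly: "tf_eval r z = rpoly (fst (quot_of_fract r)) z / rpoly (snd (quot_of_fract r)) z"
  by (simp_all add: tf_den_def tf_eval_def tf_num_def rpoly_def)

text \<open>From p' q = p q' and coprimality of p' and q', the reduced denominator q' divides q. A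
  pole is thus a root of every denominator, so sums and products can be evaluated through unreduced
  fractions.\<close>

lemma tf_Fract:
  assumes "rpoly q z \<noteq> 0"
  shows tf_den_Fract: "tf_den (Fract p q) z \<noteq> 0"
    and tf_eval_Fract: "tf_eval (Fract p q) z = rpoly p z / rpoly q z"
proof -
  define p' q' where "p' = fst (quot_of_fract (Fract p q))" and "q' = snd (quot_of_fract (Fract p q))"
  have "q \<noteq> 0" using assms by auto
  have "q' \<noteq> 0" by (simp add: q'_def)
  have "Fract p' q' = Fract p q" by (simp add: p'_def q'_def)
  then have eq: "p' * q = p * q'"
    using \<open>q \<noteq> 0\<close> \<open>q' \<noteq> 0\<close> by (simp add: eq_fract)
  have "coprime p' q'"
    using quot_of_fract_in_normalized_fracts[of "Fract p q"]
    by (simp add: normalized_fracts_def p'_def q'_def case_prod_unfold)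
  then have "q' dvd q"
    using eq by (metis coprime_commute coprime_dvd_mult_right_iff dvd_triv_right)
  then have q': "rpoly q' z \<noteq> 0" using assms by (auto elim!: dvdE)
  then show "tf_den (Fract p q) z \<noteq> 0" by (simp add: tf_den_rpoly q'_def)
  have "rpoly p' z * rpoly q z = rpoly p z * rpoly q' z"
    using eq by (metis rpoly_simps(2))
  then show "tf_eval (Fract p q) z = rpoly p z / rpoly q z"
    using q' assms by (simp add: tf_eval_rpoly frac_eq_eq flip: p'_def q'_def)
qed

lemma tf_eval_add [simp]:
  assumes "tf_den r z \<noteq> 0" "tf_den s z \<noteq> 0"
  shows "tf_den (r + s) z \<noteq> 0" "tf_eval (r + s) z = tf_eval r z + tf_eval s z"
proof -
  define a b c d where "a = fst (quot_of_fract r)" "b = snd (quot_of_fract r)"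
    "c = fst (quot_of_fract s)" "d = snd (quot_of_fract s)"
  note defs = this
  have "r + s = Fract a b + Fract c d" by (simp add: defs)
  also have "\<dots> = Fract (a * d + c * b) (b * d)"
    by (simp add: defs del: Fract_quot_of_fract)
  finally have eq: "r + s = Fract (a * d + c * b) (b * d)" .
  have nz: "rpoly b z \<noteq> 0" "rpoly d z \<noteq> 0" using assms by (simp_all add: tf_den_rpoly defs)
  then have "rpoly (b * d) z \<noteq> 0" by simp
  from tf_Fract[OF this, of "a * d + c * b"] nz
  show "tf_den (r + s) z \<noteq> 0" "tf_eval (r + s) z = tf_eval r z + tf_eval s z"
    unfolding eq by (simp_all add: tf_eval_rpoly add_divide_distrib flip: defs)
qed

lemma tf_eval_mult [simp]:
  assumes "tf_den r z \<noteq> 0" "tf_den s z \<noteq> 0"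
  shows "tf_den (r * s) z \<noteq> 0" "tf_eval (r * s) z = tf_eval r z * tf_eval s z"
proof -
  define a b c d where "a = fst (quot_of_fract r)" "b = snd (quot_of_fract r)"
    "c = fst (quot_of_fract s)" "d = snd (quot_of_fract s)"
  note defs = this
  have "r * s = Fract a b * Fract c d" by (simp add: defs)
  also have "\<dots> = Fract (a * c) (b * d)"
    by (simp add: defs del: Fract_quot_of_fract)
  finally have eq: "r * s = Fract (a * c) (b * d)" .
  have nz: "rpoly b z \<noteq> 0" "rpoly d z \<noteq> 0" using assms by (simp_all add: tf_den_rpoly defs)
  then have "rpoly (b * d) z \<noteq> 0" by simp
  from tf_Fract[OF this, of "a * c"] nz
  show "tf_den (r * s) z \<noteq> 0" "tf_eval (r * s) z = tf_eval r z * tf_eval s z"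
    unfolding eq by (simp_all add: tf_eval_rpoly flip: defs)
qed

lemma tf_eval_0 [simp]: "tf_den 0 z \<noteq> 0" "tf_eval 0 z = 0"
  by (simp_all add: tf_den_rpoly tf_eval_rpoly)

lemma tf_eval_1 [simp]: "tf_den 1 z \<noteq> 0" "tf_eval 1 z = 1"
  by (simp_all add: tf_den_rpoly tf_eval_rpoly)

lemma tf_eval_minus_1: "tf_den (- 1) z \<noteq> 0" "tf_eval (- 1) z = - 1"
proof -
  have "rpoly (- 1) z = - 1"
    using rpoly_simps(1)[of "- 1" 1 z] by (simp add: eq_neg_iff_add_eq_0 del: rpoly_simps(1))
  then have *: "tf_den (Fract (- 1) 1) z \<noteq> 0 \<and> tf_eval (Fract (- 1) 1) z = - 1"
    using tf_Fract[of 1 z "- 1"] by simp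
  have "Fract (- 1) 1 = (- 1 :: tf)" by (metis One_fract_def minus_fract)
  with * show "tf_den (- 1) z \<noteq> 0" "tf_eval (- 1) z = - 1" by auto
qed

lemma tf_eval_minus [simp]:
  assumes "tf_den r z \<noteq> 0"
  shows "tf_den (- r) z \<noteq> 0" "tf_eval (- r) z = - tf_eval r z"
  using tf_eval_mult[OF tf_eval_minus_1(1) assms] by (simp_all add: tf_eval_minus_1)

lemma tf_eval_diff [simp]:
  assumes "tf_den r z \<noteq> 0" "tf_den s z \<noteq> 0"
  shows "tf_den (r - s) z \<noteq> 0" "tf_eval (r - s) z = tf_eval r z - tf_eval s z"
  using tf_eval_add[of r z "- s"] assms by simp_all

lemma tf_eval_sum [simp]:
  assumes "\<And>i. i \<in> A \<Longrightarrow> tf_den (f i) z \<noteq> 0"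
  shows "tf_den (\<Sum>i\<in>A. f i) z \<noteq> 0" "tf_eval (\<Sum>i\<in>A. f i) z = (\<Sum>i\<in>A. tf_eval (f i) z)"
proof -
  have "tf_den (\<Sum>i\<in>A. f i) z \<noteq> 0 \<and> tf_eval (\<Sum>i\<in>A. f i) z = (\<Sum>i\<in>A. tf_eval (f i) z)"
    using assms by (induction A rule: infinite_finite_induct) auto
  then show "tf_den (\<Sum>i\<in>A. f i) z \<noteq> 0" "tf_eval (\<Sum>i\<in>A. f i) z = (\<Sum>i\<in>A. tf_eval (f i) z)"
    by auto
qed

lemma tf_eval_cnj: "tf_eval r (cnj z) = cnj (tf_eval r z)"
  by (simp add: tf_eval_rpoly rpoly_cnj)

lemma finite_tf_poles: "finite {z. tf_den r z = 0}"
  unfolding tf_den_rpoly by (intro finite_rpoly_roots) simp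

text \<open>A nonzero numerator has finitely many roots. The set of zeros is any infinite set, so
  that finitely many exceptional points of the circle can be left out.\<close>

lemma tf_eq_0I:
  assumes "infinite {z. tf_den r z \<noteq> 0 \<and> tf_eval r z = 0}"
  shows "r = 0"
proof (rule ccontr)
  assume "r \<noteq> 0"
  then have "finite {z. rpoly (fst (quot_of_fract r)) z = 0}"
    by (intro finite_rpoly_roots) simp
  moreover have "{z. tf_den r z \<noteq> 0 \<and> tf_eval r z = 0} \<subseteq> {z. rpoly (fst (quot_of_fract r)) z = 0}"
    by (auto simp: tf_den_rpoly tf_eval_rpoly)
  ultimately show False using assms finite_subset by blast
qed

text \<open>The circle contains the n-th roots of unity, and there are n of them; for n one larger
  than the supposed cardinality this is absurd.\<close>

lemma infinite_unit_circle: "infinite {z :: complex. cmod z = 1}"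
proof
  let ?C = "{z :: complex. cmod z = 1}"
  assume fin: "finite ?C"
  have "{z :: complex. z ^ Suc (card ?C) = 1} \<subseteq> ?C"
  proof clarify
    fix z :: complex assume "z ^ Suc (card ?C) = 1"
    then have "cmod z ^ Suc (card ?C) = 1" by (metis norm_power norm_one)
    then show "cmod z = 1" using power_eq_1_iff[of "cmod z" "Suc (card ?C)"] by simp
  qed
  then have "card {z :: complex. z ^ Suc (card ?C) = 1} \<le> card ?C"
    by (rule card_mono[OF fin])
  then show False by (simp add: card_roots_unity_eq del: power_Suc)
qed

lemma tf_F_eqI:
  assumes "r \<in> tf_F" "s \<in> tf_F" "\<And>z. cmod z = 1 \<Longrightarrow> tf_eval r z = tf_eval s z"
  shows "r = s"
proof -
  have "{z. cmod z = 1} \<subseteq> {z. tf_den (r - s) z \<noteq> 0 \<and> tf_eval (r - s) z = 0}"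
    using assms by (auto simp: tf_F_def)
  then have "r - s = 0"
    by (intro tf_eq_0I) (metis infinite_super infinite_unit_circle)
  then show ?thesis by simp
qed

lemma tf_F_closed:
  "r \<in> tf_F \<Longrightarrow> s \<in> tf_F \<Longrightarrow> r + s \<in> tf_F"
  "r \<in> tf_F \<Longrightarrow> s \<in> tf_F \<Longrightarrow> r - s \<in> tf_F"
  "r \<in> tf_F \<Longrightarrow> s \<in> tf_F \<Longrightarrow> r * s \<in> tf_F"
  "0 \<in> tf_F" "1 \<in> tf_F"
  "(\<And>i. i \<in> A \<Longrightarrow> f i \<in> tf_F) \<Longrightarrow> (\<Sum>i\<in>A. f i) \<in> tf_F"
  by (auto simp: tf_F_def)

text \<open>The filter with the single coefficient \<open>c\<close> at lag \<open>m\<close>, for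
  either sign of \<open>m\<close>. Added to one entry of a Wiener filter, it is the variation from
  which orthogonality follows.\<close>

definition tf_shift :: "real \<Rightarrow> int \<Rightarrow> tf" where
  "tf_shift c m = (if m \<ge> 0 then Fract (monom c 0) (monom 1 (nat m)) else Fract (monom c (nat (- m))) 1)"

lemma tf_shift_in_F: "tf_shift c m \<in> tf_F"
  and tf_eval_shift: "cmod z = 1 \<Longrightarrow> tf_eval (tf_shift c m) z = of_real c * z powi (- m)"
proof -
  show "tf_shift c m \<in> tf_F"
    by (auto simp: tf_F_def tf_shift_def intro!: tf_den_Fract)
  show "tf_eval (tf_shift c m) z = of_real c * z powi (- m)" if "cmod z = 1"
  proof -
    have "z \<noteq> 0" using that by auto
    then show ?thesis
      by (auto simp: tf_shift_def tf_eval_Fract power_int_def field_simps)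
  qed
qed

section \<open>Absolutely convergent Fourier series on the unit circle\<close>

text \<open>A common notion for transfer functions, spectral densities and correlations of two
  processes; complex coefficients admit factors with non-real poles.\<close>

definition fourier :: "(int \<Rightarrow> complex) \<Rightarrow> (complex \<Rightarrow> complex) \<Rightarrow> bool" where
  "fourier p f \<longleftrightarrow> (\<forall>z. cmod z = 1 \<longrightarrow> ((\<lambda>k. p k * z powi (- k)) has_sum f z) UNIV)"

lemma cmod_powi_unit: "cmod z = 1 \<Longrightarrow> cmod (z powi k) = 1"
  by (simp add: norm_power_int)

text \<open>At \<open>z = 1\<close> the series is the coefficient sequence itself, and unconditional
  convergence in the complex numbers is absolute.\<close>

lemma fourier_abs_summable:
  assumes "fourier p f"
  shows "(\<lambda>k. cmod (p k)) summable_on UNIV"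
proof -
  have "((\<lambda>k. p k * 1 powi (- k)) has_sum f 1) UNIV"
    using assms norm_one unfolding fourier_def by blast
  then show ?thesis
    by (simp add: has_sum_imp_summable flip: summable_on_iff_abs_summable_on_complex)
qed

lemma fourier_cong: "fourier p f \<Longrightarrow> (\<And>z. cmod z = 1 \<Longrightarrow> f z = g z) \<Longrightarrow> fourier p g"
  by (simp add: fourier_def)

lemma fourier_add: "fourier p f \<Longrightarrow> fourier q g \<Longrightarrow> fourier (\<lambda>k. p k + q k) (\<lambda>z. f z + g z)"
  by (auto simp: fourier_def ring_distribs intro!: has_sum_add)

lemma fourier_cmult: "fourier p f \<Longrightarrow> fourier (\<lambda>k. c * p k) (\<lambda>z. c * f z)"
  unfolding fourier_def by (auto simp: mult.assoc intro!: has_sum_cmult_right)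

lemma fourier_diff: "fourier p f \<Longrightarrow> fourier q g \<Longrightarrow> fourier (\<lambda>k. p k - q k) (\<lambda>z. f z - g z)"
  using fourier_add[OF _ fourier_cmult[of q g "- 1"], of p f] by simp

lemma fourier_0: "fourier (\<lambda>k. 0) (\<lambda>z. 0)"
  by (simp add: fourier_def)

lemma fourier_sum:
  "(\<And>i. i \<in> A \<Longrightarrow> fourier (p i) (f i)) \<Longrightarrow> fourier (\<lambda>k. \<Sum>i\<in>A. p i k) (\<lambda>z. \<Sum>i\<in>A. f i z)"
  by (induction A rule: infinite_finite_induct) (auto intro: fourier_add fourier_0)

lemma fourier_cnj:
  assumes "fourier p f"
  shows "fourier (\<lambda>k. cnj (p k)) (\<lambda>z. cnj (f (cnj z)))"
  unfolding fourier_def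
proof (intro allI impI)
  fix z :: complex assume "cmod z = 1"
  then have "((\<lambda>k. p k * cnj z powi (- k)) has_sum f (cnj z)) UNIV"
    using assms by (simp add: fourier_def)
  then have "((\<lambda>k. cnj (p k * cnj z powi (- k))) has_sum cnj (f (cnj z))) UNIV"
    by (simp only: has_sum_cnj_iff)
  then show "((\<lambda>k. cnj (p k) * z powi (- k)) has_sum cnj (f (cnj z))) UNIV"
    by simp
qed

text \<open>On the circle \<open>cnj z\<close> is \<open>inverse z\<close>, so conjugating the
  argument reverses the index. This accounts for interchanging the two factors of a
  correlation.\<close>

lemma fourier_reflect:
  assumes "fourier p f"
  shows "fourier (\<lambda>k. p (- k)) (\<lambda>z. f (cnj z))"
  unfolding fourier_def
proof (intro allI impI)
  fix z :: complex assume z: "cmod z = 1"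
  then have "cnj z = inverse z"
    by (simp add: inverse_complex_def complex_eq_iff cmod_def)
  then have "((\<lambda>k. p k * inverse z powi (- k)) has_sum f (cnj z)) UNIV"
    using assms z by (simp add: fourier_def norm_inverse)
  moreover have "bij (uminus :: int \<Rightarrow> int)" by (simp add: bij_uminus)
  ultimately show "((\<lambda>k. p (- k) * z powi (- k)) has_sum f (cnj z)) UNIV"
    by (subst has_sum_reindex_bij_betw[of uminus UNIV UNIV, symmetric])
       (auto simp: power_int_inverse power_int_minus)
qed

lemma fourier_shift:
  assumes "fourier p f"
  shows "fourier (\<lambda>k. p (k + m)) (\<lambda>z. f z * z powi m)"
  unfolding fourier_def
proof (intro allI impI)
  fix z :: complex assume z: "cmod z = 1"
  then have "z \<noteq> 0" by auto
  have "((\<lambda>k. p k * z powi (- k) * z powi m) has_sum f z * z powi m) UNIV"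
    using assms z by (intro has_sum_cmult_left) (simp add: fourier_def)
  moreover have "bij (\<lambda>k :: int. k + m)" by (rule bij_plus_right)
  ultimately have "((\<lambda>k. p (k + m) * z powi (- (k + m)) * z powi m) has_sum f z * z powi m) UNIV"
    by (subst has_sum_reindex_bij_betw[of "\<lambda>k. k + m" UNIV UNIV]) auto
  moreover have "z powi (- (k + m)) * z powi m = z powi (- k)" for k
    using \<open>z \<noteq> 0\<close> by (simp flip: power_int_add)
  ultimately show "((\<lambda>k. p (k + m) * z powi (- k)) has_sum f z * z powi m) UNIV"
    by (simp add: mult.assoc)
qed

text \<open>Absolute summability of both factors makes the family \<open>a k * b l\<close> summable
  over pairs; summing it along the lines \<open>k + l = n\<close> produces the convolution.\<close>

lemma fourier_mult:
  assumes p: "fourier p f" and q: "fourier q g"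
  shows "fourier (\<lambda>n. \<Sum>\<^sub>\<infinity>k. p (n - k) * q k) (\<lambda>z. f z * g z)"
  unfolding fourier_def
proof (intro allI impI)
  fix z :: complex assume z: "cmod z = 1"
  then have "z \<noteq> 0" by auto
  define a b where "a k = p k * z powi (- k)" and "b k = q k * z powi (- k)" for k
  have a: "(a has_sum f z) UNIV" and b: "(b has_sum g z) UNIV"
    using p q z unfolding fourier_def a_def[abs_def] b_def[abs_def] by blast+
  have "(\<lambda>x. norm ((\<lambda>(k, l). a k * b l) x)) summable_on UNIV \<times> UNIV"
  proof (subst Infinite_Sum.abs_summable_on_Sigma_iff, intro conjI ballI)
    have b': "(\<lambda>k. cmod (b k)) summable_on UNIV" and a': "(\<lambda>k. cmod (a k)) summable_on UNIV"
      using a b by (auto simp: has_sum_imp_summable simp flip: summable_on_iff_abs_summable_on_complex)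
    show "(\<lambda>l. norm (case (k, l) of (k, l) \<Rightarrow> a k * b l)) summable_on UNIV" for k
      using b' by (auto simp: norm_mult intro: summable_on_cmult_right)
    show "(\<lambda>k. norm (\<Sum>\<^sub>\<infinity>l. norm (case (k, l) of (k, l) \<Rightarrow> a k * b l))) summable_on UNIV"
      using a' b' by (auto simp: norm_mult infsum_cmult_right infsum_nonneg abs_mult intro: summable_on_cmult_left)
  qed
  then have "(\<lambda>(k, l). a k * b l) summable_on UNIV \<times> UNIV"
    by (rule abs_summable_summable)
  then have "((\<lambda>(k, l). a k * b l) has_sum f z * g z) (UNIV \<times> UNIV)"
    using a b by (intro has_sum_SigmaI[where g = "\<lambda>k. a k * g z"])
      (auto intro: has_sum_cmult_left has_sum_cmult_right)
  also have "?this \<longleftrightarrow> ((\<lambda>(n, k). a (n - k) * b k) has_sum f z * g z) (UNIV \<times> UNIV)"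
    by (rule has_sum_reindex_bij_witness[of _ "\<lambda>(n, k). (n - k, k)" "\<lambda>(k, l). (k + l, l)"]) auto
  finally have ab: "((\<lambda>(n, k). a (n - k) * b k) has_sum f z * g z) (UNIV \<times> UNIV)" .
  \<comment> \<open>Each inner series converges, so the \<open>infsum\<close> in the convolution is
    a genuine sum and not a default value.\<close>
  have inner: "(\<lambda>k. a (n - k) * b k) summable_on UNIV" for n
    using summable_on_SigmaD1[of "\<lambda>n k. a (n - k) * b k" UNIV "\<lambda>_. UNIV" n] ab
    by (auto simp: has_sum_imp_summable)
  have ab_eq: "a (n - k) * b k = z powi (- n) * (p (n - k) * q k)" for n k
  proof -
    have "z powi (- (n - k)) * z powi (- k) = z powi (- n)"
      using \<open>z \<noteq> 0\<close> by (simp flip: power_int_add)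
    then show ?thesis by (simp add: a_def b_def)
  qed
  have "((\<lambda>n. \<Sum>\<^sub>\<infinity>k. a (n - k) * b k) has_sum f z * g z) UNIV"
    by (rule has_sum_SigmaD[OF ab]) (use inner in auto)
  also have "(\<lambda>n. \<Sum>\<^sub>\<infinity>k. a (n - k) * b k) = (\<lambda>n. (\<Sum>\<^sub>\<infinity>k. p (n - k) * q k) * z powi (- n))"
    unfolding ab_eq by (simp add: infsum_cmult_right' mult.commute)
  finally show "((\<lambda>n. (\<Sum>\<^sub>\<infinity>k. p (n - k) * q k) * z powi (- n)) has_sum f z * g z) UNIV" .
qed

section \<open>Uniqueness of the coefficients by averaging over roots of unity\<close>

text \<open>Multiplication by the primitive root \<open>w\<close> permutes the roots of unity, so
  the sum equals \<open>w powi k\<close> times itself; the bounds on \<open>k\<close> exclude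
  \<open>w powi k = 1\<close>.\<close>

lemma sum_powi_roots_of_unity:
  assumes "k \<noteq> 0" "\<bar>k\<bar> < int N"
  shows "(\<Sum>z | z ^ N = 1. z powi k :: complex) = 0"
proof -
  have N: "N > 0" using assms by auto
  define w where "w = cis (2 * pi / real N)"
  have "w \<noteq> 0" by (simp add: w_def)
  have wN: "w ^ N = 1" unfolding w_def Complex.DeMoivre using N by (simp add: cis_2pi)
  have wk: "w powi k = cis (2 * pi * (of_int k / real N))"
    by (simp add: w_def cis_power_int field_simps)
  have "w powi k \<noteq> 1"
  proof
    assume "w powi k = 1"
    then have "cos (2 * pi * (of_int k / real N)) = 1"
      using wk by (simp add: complex_eq_iff)
    then obtain m :: int where "2 * pi * (of_int k / real N) = of_int m * 2 * pi"
      by (auto simp: cos_one_2pi_int)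
    then have "of_int k = real_of_int (m * int N)" using N by (simp add: field_simps)
    then have "k = m * int N" by (simp only: of_int_eq_iff)
    with assms(1) have "\<bar>m\<bar> \<ge> 1" by auto
    then have "\<bar>k\<bar> \<ge> int N"
      using mult_right_mono[of 1 "\<bar>m\<bar>" "int N"] \<open>k = _\<close> by (simp add: abs_mult)
    then show False using assms(2) by simp
  qed
  have "bij_betw (\<lambda>z. w * z) {z. z ^ N = 1} {z. z ^ N = 1}"
    by (rule bij_betwI[where g = "\<lambda>z. z / w"]) (use wN \<open>w \<noteq> 0\<close> in \<open>auto simp: power_mult_distrib power_divide\<close>)
  then have "(\<Sum>z | z ^ N = 1. z powi k) = (\<Sum>z | z ^ N = 1. (w * z) powi k)"
    by (rule sum.reindex_bij_betw[symmetric])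
  also have "\<dots> = w powi k * (\<Sum>z | z ^ N = 1. z powi k)"
    by (simp add: power_int_mult_distrib sum_distrib_left)
  finally show ?thesis using \<open>w powi k \<noteq> 1\<close> by simp
qed

text \<open>The mean over the \<open>N\<close>-th roots of unity replaces the integral over the
  circle. A finite index set \<open>F\<close> carries the absolute sum up to \<epsilon>, so the
  partial sum over \<open>F\<close> is at most \<epsilon> in modulus where the full series vanishes;
  its mean over the roots is exactly \<open>p 0\<close>.\<close>

lemma fourier_zero_coeff_0:
  assumes "fourier p (\<lambda>z. 0)"
  shows "p 0 = 0"
proof -
  have "cmod (p 0) \<le> \<epsilon>" if "\<epsilon> > 0" for \<epsilon>
  proof -
    obtain L where L: "((\<lambda>k. cmod (p k)) has_sum L) UNIV"
      using fourier_abs_summable[OF assms] by (auto simp: summable_on_def)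
    then obtain X where "finite X" and
      X: "\<And>Y. finite Y \<Longrightarrow> X \<subseteq> Y \<Longrightarrow> dist (\<Sum>k\<in>Y. cmod (p k)) L < \<epsilon>"
      using \<open>\<epsilon> > 0\<close> unfolding has_sum_def tendsto_iff eventually_finite_subsets_at_top
      by (metis subset_UNIV)
    \<comment> \<open>The index 0 is added so that the partial sum contains
      \<open>p 0\<close>.\<close>
    define F where "F = insert 0 X"
    have F: "finite F" "0 \<in> F" "dist (\<Sum>k\<in>F. cmod (p k)) L < \<epsilon>"
      using X[of F] \<open>finite X\<close> by (auto simp: F_def)
    have tail: "((\<lambda>k. cmod (p k)) has_sum L - (\<Sum>k\<in>F. cmod (p k))) (- F)"
      using has_sum_Diff[OF L has_sum_finite[OF F(1)] subset_UNIV] by (simp add: Compl_eq_Diff_UNIV)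
    have T: "cmod (\<Sum>k\<in>F. p k * z powi (- k)) \<le> \<epsilon>" if z: "cmod z = 1" for z
    proof -
      have "((\<lambda>k. p k * z powi (- k)) has_sum 0 - (\<Sum>k\<in>F. p k * z powi (- k))) (- F)"
        using assms z unfolding Compl_eq_Diff_UNIV
        by (intro has_sum_Diff has_sum_finite F) (auto simp: fourier_def)
      moreover have "((\<lambda>k. norm (p k * z powi (- k))) has_sum L - (\<Sum>k\<in>F. cmod (p k))) (- F)"
        using tail z by (simp add: norm_mult cmod_powi_unit)
      ultimately have "norm (0 - (\<Sum>k\<in>F. p k * z powi (- k))) \<le> L - (\<Sum>k\<in>F. cmod (p k))"
        by (rule norm_has_sum_bound[rotated])
      also have "\<dots> \<le> \<epsilon>" using F(3) by (simp add: dist_real_def)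
      finally show ?thesis by simp
    qed
    \<comment> \<open>\<open>N\<close> exceeds every \<open>\<bar>k\<bar>\<close> with
      \<open>k \<in> F\<close>, so each nonzero index in \<open>F\<close> averages to 0.\<close>
    define N where "N = Suc (nat (\<Sum>k\<in>F. \<bar>k\<bar>))"
    have N: "\<bar>k\<bar> < int N" if "k \<in> F" for k
      using member_le_sum[of k F abs] F(1) that by (simp add: N_def)
    let ?S = "{z :: complex. z ^ N = 1}"
    have S: "finite ?S" "card ?S = N"
      by (simp_all add: N_def finite_roots_unity card_roots_unity_eq del: power_Suc)
    have cm: "cmod z = 1" if "z \<in> ?S" for z
      using that by (metis (mono_tags) mem_Collect_eq N_def nat.simps(3) norm_ge_zero norm_one norm_power power_eq_1_iff)
    have "(\<Sum>z\<in>?S. \<Sum>k\<in>F. p k * z powi (- k)) = (\<Sum>k\<in>F. p k * (\<Sum>z\<in>?S. z powi (- k)))"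
      by (subst sum.swap) (simp add: sum_distrib_left)
    also have "\<dots> = (\<Sum>k\<in>F. if k = 0 then of_nat N * p k else 0)"
      using N S by (intro sum.cong) (auto simp: sum_powi_roots_of_unity)
    also have "\<dots> = of_nat N * p 0"
      using F by (simp add: sum.delta)
    finally have "real N * cmod (p 0) = cmod (\<Sum>z\<in>?S. \<Sum>k\<in>F. p k * z powi (- k))"
      by (simp add: norm_mult)
    also have "\<dots> \<le> (\<Sum>z\<in>?S. \<epsilon>)"
      using T cm by (intro sum_norm_le) auto
    also have "\<dots> = real N * \<epsilon>" using S by simp
    finally show ?thesis by (rule mult_left_le_imp_le) (simp add: N_def del: of_nat_Suc)
  qed
  then have "cmod (p 0) \<le> 0" by (meson dense_ge)
  then show ?thesis by simp
qed

text \<open>Shifting the difference by \<open>m\<close> moves its coefficient at \<open>m\<close> to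
  the index 0.\<close>

lemma fourier_unique:
  assumes "fourier p f" "fourier q f"
  shows "p = q"
proof
  fix m
  have "fourier (\<lambda>k. p k - q k) (\<lambda>z. 0)"
    using fourier_diff[OF assms] by simp
  from fourier_shift[OF this, of m] have "fourier (\<lambda>k. p (k + m) - q (k + m)) (\<lambda>z. 0)" by simp
  from fourier_zero_coeff_0[OF this] show "p m = q m" by simp
qed

section \<open>Expansion of rational functions without poles on the circle\<close>

lemma fourier_monom: "fourier (\<lambda>k. if k = m then c else 0) (\<lambda>z. c * z powi (- m))"
  unfolding fourier_def
  by (intro allI impI has_sum_finite_neutralI[of "{m}"]) auto

text \<open>Meant for one-sided series: \<open>h\<close> enumerates the support of
  \<open>p\<close>.\<close>

lemma fourier_inj:
  assumes "inj h" "\<And>z. cmod z = 1 \<Longrightarrow> ((\<lambda>n. p (h n) * z powi (- h n)) has_sum f z) UNIV"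
    and "\<And>k. k \<notin> range h \<Longrightarrow> p k = 0"
  shows "fourier p f"
  unfolding fourier_def
proof (intro allI impI)
  fix z :: complex assume z: "cmod z = 1"
  have "((\<lambda>k. p k * z powi (- k)) has_sum f z) (range h)"
    using assms(1) assms(2)[OF z] by (subst has_sum_reindex) (auto simp: o_def)
  then show "((\<lambda>k. p k * z powi (- k)) has_sum f z) UNIV"
    by (rule has_sum_cong_neutral[THEN iffD1, rotated 3]) (use assms(3) in auto)
qed

lemma has_sum_geometric:
  fixes c x :: complex
  assumes "cmod x < 1"
  shows "((\<lambda>n. c * x ^ n) has_sum c / (1 - x)) UNIV"
proof -
  have "((\<lambda>n. x ^ n) has_sum 1 / (1 - x)) UNIV"
    using assms by (intro norm_summable_imp_has_sum geometric_sums) (simp_all add: norm_power summable_geometric)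
  from has_sum_cmult_right[OF this, of c] show ?thesis by simp
qed

text \<open>A pole inside the circle is expanded in powers of \<open>inverse z\<close>, with indices
  from 1 on, a pole outside in powers of \<open>z\<close>, with indices up to 0. This is where
  non-causal expansions arise.\<close>

lemma fourier_inverse_linear:
  assumes "cmod a \<noteq> 1"
  shows "\<exists>p. fourier p (\<lambda>z. 1 / (z - a))"
proof (cases "cmod a < 1")
  case True
  have "fourier (\<lambda>k. if k \<ge> 1 then a ^ nat (k - 1) else 0) (\<lambda>z. 1 / (z - a))"
  proof (rule fourier_inj[of "\<lambda>n. int n + 1"])
    fix z :: complex assume z: "cmod z = 1"
    then have [simp]: "z \<noteq> 0" by auto
    have "z \<noteq> a" using z True by auto
    have "((\<lambda>n. inverse z * (a / z) ^ n) has_sum inverse z / (1 - a / z)) UNIV"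
      using z True by (intro has_sum_geometric) (simp add: norm_divide)
    also have "inverse z / (1 - a / z) = 1 / (z - a)"
      using \<open>z \<noteq> a\<close> by (simp add: field_simps)
    finally show "((\<lambda>n. (if int n + 1 \<ge> 1 then a ^ nat (int n + 1 - 1) else 0) * z powi - (int n + 1)) has_sum
        1 / (z - a)) UNIV"
      by (simp add: power_int_diff power_int_minus field_simps)
  next
    fix k :: int assume "k \<notin> range (\<lambda>n. int n + 1)"
    moreover have "k = int (nat (k - 1)) + 1" if "1 \<le> k" using that by simp
    ultimately have "\<not> 1 \<le> k" by blast
    then show "(if 1 \<le> k then a ^ nat (k - 1) else 0) = 0" by simp
  qed (auto simp: inj_def)
  then show ?thesis by (intro exI)
next
  case False
  with assms have a: "cmod a > 1" by simp
  then have [simp]: "a \<noteq> 0" by auto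
  have "fourier (\<lambda>k. if k \<le> 0 then - (1 / a) * (1 / a) ^ nat (- k) else 0) (\<lambda>z. 1 / (z - a))"
  proof (rule fourier_inj[of "\<lambda>n. - int n"])
    fix z :: complex assume z: "cmod z = 1"
    have "z \<noteq> a" using z a by auto
    have "((\<lambda>n. - (1 / a) * (z / a) ^ n) has_sum - (1 / a) / (1 - z / a)) UNIV"
      using z a by (intro has_sum_geometric) (simp add: norm_divide)
    also have "- (1 / a) / (1 - z / a) = 1 / (z - a)"
      using \<open>z \<noteq> a\<close> by (simp add: field_simps)
    finally show "((\<lambda>n. (if - int n \<le> 0 then - (1 / a) * (1 / a) ^ nat (- (- int n)) else 0) *
        z powi - (- int n)) has_sum 1 / (z - a)) UNIV"
      by (simp add: field_simps)
  next
    fix k :: int assume "k \<notin> range (\<lambda>n. - int n)"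
    moreover have "k = - int (nat (- k))" if "k \<le> 0" using that by simp
    ultimately have "\<not> k \<le> 0" by blast
    then show "(if k \<le> 0 then - (1 / a) * (1 / a) ^ nat (- k) else 0) = 0" by simp
  qed (auto simp: inj_def)
  then show ?thesis by (intro exI)
qed

text \<open>Over the complex numbers \<open>q\<close> splits into linear factors, none with its root
  on the circle; the expansions of their inverses are multiplied.\<close>

lemma fourier_inverse_poly:
  fixes q :: "complex poly"
  assumes "\<And>z. cmod z = 1 \<Longrightarrow> poly q z \<noteq> 0"
  shows "\<exists>p. fourier p (\<lambda>z. 1 / poly q z)"
proof -
  have "q \<noteq> 0" using assms[of 1] by auto
  then obtain A where q: "q = smult (lead_coeff q) (\<Prod>x\<in>#A. [:- x, 1:])"
    using alg_closed_imp_factorization[OF \<open>q \<noteq> 0\<close>] by (elim exE conjE)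
  define g where "g = (\<Prod>x\<in>#A. [:- x, 1:])"
  have qg: "poly q z = lead_coeff q * poly g z" for z
    using arg_cong[OF q, of "\<lambda>q. poly q z"] by (simp only: poly_smult g_def)
  have A: "cmod x \<noteq> 1" if "x \<in># A" for x
  proof
    assume "cmod x = 1"
    moreover have "poly q x = 0"
      using that unfolding qg by (auto simp: poly_prod_mset g_def)
    ultimately show False using assms by blast
  qed
  then have "\<exists>p. fourier p (\<lambda>z. 1 / poly (\<Prod>x\<in>#A. [:- x, 1:]) z)"
  proof (induction A)
    case empty
    show ?case using exI[of "\<lambda>p. fourier p (\<lambda>z. 1)", OF fourier_monom[of 0 1, simplified]] by simp
  next
    case (add x A)
    have "cmod y \<noteq> 1" if "y \<in># A" for y using add.prems[of y] that by simp
    then obtain p where p: "fourier p (\<lambda>z. 1 / poly (\<Prod>x\<in>#A. [:- x, 1:]) z)"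
      using add.IH by metis
    have "cmod x \<noteq> 1" using add.prems[of x] by simp
    then obtain p' where p': "fourier p' (\<lambda>z. 1 / (z - x))"
      using fourier_inverse_linear by metis
    have "\<exists>r. fourier r (\<lambda>z. 1 / (z - x) * (1 / poly (\<Prod>x\<in>#A. [:- x, 1:]) z))"
      by (rule exI, rule fourier_mult[OF p' p])
    moreover have "1 / (z - x) * (1 / poly (\<Prod>x\<in>#A. [:- x, 1:]) z) =
        1 / poly (\<Prod>x\<in>#add_mset x A. [:- x, 1:]) z" for z
      by (simp add: left_diff_distrib)
    ultimately show ?case by simp
  qed
  then obtain p where "fourier p (\<lambda>z. 1 / poly g z)" unfolding g_def by (elim exE)
  from fourier_cmult[OF this, of "1 / lead_coeff q"]
  have "fourier (\<lambda>k. 1 / lead_coeff q * p k) (\<lambda>z. 1 / poly q z)"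
    unfolding qg by simp
  then show ?thesis by (intro exI)
qed

lemma fourier_poly: "\<exists>p. fourier p (poly q)"
proof (induction q)
  case 0
  show ?case using fourier_0 by auto
next
  case (pCons a q)
  then obtain p where "fourier p (poly q)" by auto
  \<comment> \<open>A Horner step: with the exponent convention \<open>z powi (- k)\<close>, the
    factor \<open>z\<close> is the monomial of index - 1.\<close>
  from fourier_add[OF fourier_monom[of 0 a] fourier_mult[OF fourier_monom[of "- 1" 1] this]]
  have "\<exists>r. fourier r (\<lambda>z. a * z powi (- 0) + 1 * z powi (- (- 1)) * poly q z)" by (intro exI)
  moreover have "(\<lambda>z. a * z powi (- 0) + 1 * z powi (- (- 1)) * poly q z) = poly (pCons a q)"
    by (rule ext) simp
  ultimately show ?case by (simp only:)
qed

text \<open>The description \<open>tf_coeff\<close> ranges over real sequences. A complex expansion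
  comes from the numerator and the inverse denominator; the symmetry of a real function under
  conjugation, together with uniqueness, makes its coefficients real.\<close>

lemma fourier_tf_coeff:
  assumes "r \<in> tf_F"
  shows "fourier (\<lambda>k. complex_of_real (tf_coeff r k)) (tf_eval r)"
proof -
  obtain a b where "fourier a (tf_num r)" "fourier b (\<lambda>z. 1 / tf_den r z)"
    using assms fourier_poly fourier_inverse_poly unfolding tf_num_def tf_den_def tf_F_def by blast
  from fourier_mult[OF this] obtain p where p: "fourier p (tf_eval r)"
    unfolding tf_eval_def[abs_def] by auto
  have "(\<lambda>k. cnj (p k)) = p"
    using fourier_cnj[OF p] by (intro fourier_unique[OF _ p]) (simp add: tf_eval_cnj)
  then have "of_real (Re (p k)) = p k" for k
    by (metis Reals_cnj_iff of_real_Re)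
  then have ex: "fourier (\<lambda>k. of_real (Re (p k))) (tf_eval r)" using p by simp
  have eq: "(\<lambda>k. complex_of_real (p' k)) = (\<lambda>k. complex_of_real (p'' k)) \<Longrightarrow> p' = p''"
    for p' p'' :: "int \<Rightarrow> real"
    by (auto simp: fun_eq_iff)
  have "fourier (\<lambda>k. of_real ((THE p. fourier (\<lambda>k. of_real (p k)) (tf_eval r)) k)) (tf_eval r)"
    by (rule theI[of "\<lambda>p. fourier (\<lambda>k. of_real (p k)) (tf_eval r)"], rule ex)
       (auto intro!: eq fourier_unique[OF _ ex])
  then show ?thesis by (simp add: fourier_def tf_coeff_def)
qed

lemma tf_coeff_unique:
  assumes "r \<in> tf_F" "fourier (\<lambda>k. of_real (p k)) (tf_eval r)"
  shows "tf_coeff r k = p k"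
  using fun_cong[OF fourier_unique[OF fourier_tf_coeff[OF assms(1)] assms(2)], of k] by simp

lemma tf_coeff_summable: "r \<in> tf_F \<Longrightarrow> (\<lambda>k. \<bar>tf_coeff r k\<bar>) summable_on UNIV"
  using fourier_abs_summable[OF fourier_tf_coeff] by simp

lemma tf_coeff_add_shift:
  assumes "r \<in> tf_F"
  shows "tf_coeff (r + tf_shift c m) k = tf_coeff r k + (if k = m then c else 0)"
proof (rule tf_coeff_unique)
  show "r + tf_shift c m \<in> tf_F" using assms by (intro tf_F_closed tf_shift_in_F)
  have "tf_eval (r + tf_shift c m) z = tf_eval r z + of_real c * z powi (- m)" if "cmod z = 1" for z
    using that assms tf_shift_in_F[of c m] by (simp add: tf_F_def tf_eval_shift)
  moreover have "(if k = m then of_real c else 0) = complex_of_real (if k = m then c else 0)" for k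
    by simp
  ultimately show "fourier (\<lambda>k. of_real (tf_coeff r k + (if k = m then c else 0))) (tf_eval (r + tf_shift c m))"
    using fourier_add[OF fourier_tf_coeff[OF assms] fourier_monom[of m "of_real c"]]
    by (auto elim!: fourier_cong)
qed

section \<open>Filtering of square integrable processes\<close>

definition sqint :: "'w measure \<Rightarrow> ('w \<Rightarrow> real) \<Rightarrow> bool" where
  "sqint M f \<longleftrightarrow> f \<in> borel_measurable M \<and> integrable M (\<lambda>\<omega>. (f \<omega>)\<^sup>2)"

lemma abs_mult_le_sum_squares: "\<bar>a * b\<bar> \<le> a\<^sup>2 + b\<^sup>2" for a b :: real
  using sum_squares_bound[of "\<bar>a\<bar>" "\<bar>b\<bar>"] abs_ge_zero[of "a * b"]
  unfolding power2_abs abs_mult by linarith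

lemma sqint_integrable_mult:
  assumes "sqint M f" "sqint M g"
  shows "integrable M (\<lambda>\<omega>. f \<omega> * g \<omega>)"
proof (rule Bochner_Integration.integrable_bound)
  show "integrable M (\<lambda>\<omega>. (f \<omega>)\<^sup>2 + (g \<omega>)\<^sup>2)"
    using assms by (auto simp: sqint_def)
  show "(\<lambda>\<omega>. f \<omega> * g \<omega>) \<in> borel_measurable M"
    using assms by (auto simp: sqint_def)
  show "AE \<omega> in M. norm (f \<omega> * g \<omega>) \<le> norm ((f \<omega>)\<^sup>2 + (g \<omega>)\<^sup>2)"
    using abs_mult_le_sum_squares by (intro AE_I2) simp
qed

lemma sqint_add:
  assumes "sqint M f" "sqint M g"
  shows "sqint M (\<lambda>\<omega>. f \<omega> + g \<omega>)"
proof -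
  have "integrable M (\<lambda>\<omega>. (f \<omega>)\<^sup>2 + (g \<omega>)\<^sup>2 + 2 * (f \<omega> * g \<omega>))"
    using assms sqint_integrable_mult[OF assms]
    by (intro Bochner_Integration.integrable_add integrable_mult_right) (simp_all add: sqint_def)
  then show ?thesis
    using assms by (auto simp: sqint_def power2_sum mult.assoc intro: borel_measurable_add)
qed

lemma sqint_cmult: "sqint M f \<Longrightarrow> sqint M (\<lambda>\<omega>. c * f \<omega>)"
  by (auto simp: sqint_def power_mult_distrib intro: borel_measurable_times)

lemma sqint_diff:
  assumes "sqint M f" "sqint M g"
  shows "sqint M (\<lambda>\<omega>. f \<omega> - g \<omega>)"
  using sqint_add[OF assms(1) sqint_cmult[OF assms(2), of "- 1"]] by simp

lemma sqint_0: "sqint M (\<lambda>\<omega>. 0)"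
  by (simp add: sqint_def)

lemma sqint_sum: "(\<And>i. i \<in> A \<Longrightarrow> sqint M (f i)) \<Longrightarrow> sqint M (\<lambda>\<omega>. \<Sum>i\<in>A. f i \<omega>)"
  by (induction A rule: infinite_finite_induct) (simp_all add: sqint_0 sqint_add)

section \<open>Measurability of pointwise infinite sums\<close>

text \<open>Unconditional convergence of a real series is absolute convergence; otherwise
  \<open>infsum\<close> is 0, even where the ordered series converges. The case distinction makes
  the theory of \<open>suminf\<close> available.\<close>

lemma infsum_nat_eq_suminf:
  fixes f :: "nat \<Rightarrow> real"
  shows "infsum f UNIV = (if summable (\<lambda>n. \<bar>f n\<bar>) then suminf f else 0)"
proof (cases "summable (\<lambda>n. \<bar>f n\<bar>)")
  case True
  then have "(f has_sum suminf f) UNIV"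
    using norm_summable_imp_has_sum[OF _ summable_sums[OF summable_rabs_cancel[OF True]]] by simp
  then show ?thesis using True by (simp add: infsumI)
next
  case False
  have "\<not> f summable_on UNIV"
  proof
    assume "f summable_on UNIV"
    then have "(\<lambda>n. norm (f n)) summable_on UNIV"
      by (rule iffD1[OF summable_on_iff_abs_summable_on_real])
    from summable_on_imp_summable[OF this] False show False by simp
  qed
  then show ?thesis using False by (simp add: infsum_not_exists)
qed

lemma ennreal_suminf_eq_top_iff:
  fixes f :: "nat \<Rightarrow> real"
  assumes "\<And>n. f n \<ge> 0"
  shows "(\<Sum>n. ennreal (f n)) = top \<longleftrightarrow> \<not> summable f"
proof
  show "(\<Sum>n. ennreal (f n)) = top \<Longrightarrow> \<not> summable f"
    using ennreal_suminf_neq_top[of f] assms by blast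
  show "\<not> summable f \<Longrightarrow> (\<Sum>n. ennreal (f n)) = top"
    using summable_suminf_not_top[of f] assms by blast
qed

text \<open>The outcomes with the default value 0 are those where the extended sum of absolute
  values is infinite, a measurable condition.\<close>

lemma borel_measurable_infsum_nat:
  fixes f :: "nat \<Rightarrow> 'w \<Rightarrow> real"
  assumes [measurable]: "\<And>n. f n \<in> borel_measurable M"
  shows "(\<lambda>\<omega>. \<Sum>\<^sub>\<infinity>n. f n \<omega>) \<in> borel_measurable M"
proof -
  have "(\<lambda>\<omega>. \<Sum>\<^sub>\<infinity>n. f n \<omega>) = (\<lambda>\<omega>. if (\<Sum>n. ennreal \<bar>f n \<omega>\<bar>) = top then 0 else \<Sum>n. f n \<omega>)"
    by (auto simp: infsum_nat_eq_suminf ennreal_suminf_eq_top_iff fun_eq_iff)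
  also have "\<dots> \<in> borel_measurable M" by measurable
  finally show ?thesis .
qed

lemma infsum_int_decode:
  fixes f :: "int \<Rightarrow> real"
  shows "infsum f UNIV = (\<Sum>\<^sub>\<infinity>n. f (int_decode n))"
  by (rule infsum_reindex_bij_betw[symmetric]) (rule bij_int_decode)

text \<open>
  \<open>\<bar>p x v\<bar> \<le> \<bar>p\<bar> (x\<^sup>2 + v\<^sup>2)\<close> bounds every term by an integrable function with summable integrals, so
  all exchanges of sum and expectation reduce to dominated convergence.
\<close>

context prob_space
begin

lemma sqint_series_nat:
  fixes p :: "nat \<Rightarrow> real" and x :: "nat \<Rightarrow> 'a \<Rightarrow> real"
  assumes p: "summable (\<lambda>n. \<bar>p n\<bar>)"
    and x: "\<And>n. sqint M (x n)" and B: "\<And>n. expectation (\<lambda>\<omega>. (x n \<omega>)\<^sup>2) \<le> B"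
  shows "AE \<omega> in M. summable (\<lambda>n. \<bar>p n * x n \<omega>\<bar>)" (is ?sum)
    and "sqint M (\<lambda>\<omega>. \<Sum>\<^sub>\<infinity>n. p n * x n \<omega>)" (is ?sq)
    and "sqint M v \<Longrightarrow> ((\<lambda>n. p n * expectation (\<lambda>\<omega>. x n \<omega> * v \<omega>)) has_sum
      expectation (\<lambda>\<omega>. (\<Sum>\<^sub>\<infinity>n. p n * x n \<omega>) * v \<omega>)) UNIV" (is "_ \<Longrightarrow> ?exp")
proof -
  have [measurable]: "x n \<in> borel_measurable M" for n using x by (simp add: sqint_def)
  have ix: "integrable M (\<lambda>\<omega>. (x n \<omega>)\<^sup>2)" for n using x by (simp add: sqint_def)
  have pB: "summable (\<lambda>n. \<bar>p n\<bar> * C)" for C using p by (rule summable_mult2)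
  have pxB: "summable (\<lambda>n. \<bar>p n\<bar> * expectation (\<lambda>\<omega>. (x n \<omega>)\<^sup>2))"
  proof (rule summable_comparison_test'[OF pB[of B], of 0])
    show "norm (\<bar>p n\<bar> * expectation (\<lambda>\<omega>. (x n \<omega>)\<^sup>2)) \<le> \<bar>p n\<bar> * B" for n
      using mult_left_mono[OF B[of n], of "\<bar>p n\<bar>"] by (simp add: abs_mult integral_nonneg_AE)
  qed
  have "(\<integral>\<^sup>+\<omega>. (\<Sum>n. ennreal (\<bar>p n\<bar> * (x n \<omega>)\<^sup>2)) \<partial>M) = (\<Sum>n. ennreal (\<bar>p n\<bar> * expectation (\<lambda>\<omega>. (x n \<omega>)\<^sup>2)))"
    using ix by (subst nn_integral_suminf) (auto simp: nn_integral_eq_integral)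
  also have "\<dots> \<noteq> top"
    using pxB by (subst ennreal_suminf_eq_top_iff) (auto simp: integral_nonneg_AE)
  finally have "AE \<omega> in M. (\<Sum>n. ennreal (\<bar>p n\<bar> * (x n \<omega>)\<^sup>2)) \<noteq> \<infinity>"
    by (intro nn_integral_noteq_infinite) auto
  then have AE2: "AE \<omega> in M. summable (\<lambda>n. \<bar>p n\<bar> * (x n \<omega>)\<^sup>2)"
    by (auto simp: ennreal_suminf_eq_top_iff)
  have le: "\<bar>a\<bar> \<le> 1 + a\<^sup>2" for a :: real
    using abs_mult_le_sum_squares[of 1 a] by simp
  from AE2 show sum: ?sum
  proof eventually_elim
    case (elim \<omega>)
    have "summable (\<lambda>n. \<bar>p n\<bar> + \<bar>p n\<bar> * (x n \<omega>)\<^sup>2)" by (intro summable_add p elim)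
    then show ?case
    proof (rule summable_comparison_test'[where N = 0])
      show "norm \<bar>p n * x n \<omega>\<bar> \<le> \<bar>p n\<bar> + \<bar>p n\<bar> * (x n \<omega>)\<^sup>2" for n
        using mult_left_mono[OF le[of "x n \<omega>"], of "\<bar>p n\<bar>"] by (simp add: abs_mult algebra_simps)
    qed
  qed
  have G: "integrable M (\<lambda>\<omega>. \<Sum>n. \<bar>p n\<bar> * (x n \<omega>)\<^sup>2)"
  proof (rule integrable_suminf)
    show "integrable M (\<lambda>\<omega>. \<bar>p n\<bar> * (x n \<omega>)\<^sup>2)" for n using ix by simp
    show "AE \<omega> in M. summable (\<lambda>n. norm (\<bar>p n\<bar> * (x n \<omega>)\<^sup>2))" using AE2 by (simp add: abs_mult)
    show "summable (\<lambda>n. \<integral>\<omega>. norm (\<bar>p n\<bar> * (x n \<omega>)\<^sup>2) \<partial>M)"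
      using pxB by (simp add: abs_mult)
  qed
  have meas [measurable]: "(\<lambda>\<omega>. \<Sum>\<^sub>\<infinity>n. p n * x n \<omega>) \<in> borel_measurable M"
    by (intro borel_measurable_infsum_nat) measurable
  show sq: ?sq
    unfolding sqint_def
  proof (rule conjI[OF meas], rule Bochner_Integration.integrable_bound)
    \<comment> \<open>The summand 1 makes \<open>P\<close> positive even if all coefficients vanish,
      so that division by \<open>P\<close> is possible.\<close>
    define P where "P = (\<Sum>n. \<bar>p n\<bar>) + 1"
    show "integrable M (\<lambda>\<omega>. P * (\<Sum>n. \<bar>p n\<bar> * (x n \<omega>)\<^sup>2))" using G by simp
    show "AE \<omega> in M. norm ((\<Sum>\<^sub>\<infinity>n. p n * x n \<omega>)\<^sup>2) \<le> norm (P * (\<Sum>n. \<bar>p n\<bar> * (x n \<omega>)\<^sup>2))"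
      using AE2 sum
    proof eventually_elim
      case (elim \<omega>)
      define T g where "T = (\<Sum>n. \<bar>p n * x n \<omega>\<bar>)" and "g = (\<Sum>n. \<bar>p n\<bar> * (x n \<omega>)\<^sup>2)"
      have "\<bar>\<Sum>\<^sub>\<infinity>n. p n * x n \<omega>\<bar> \<le> T"
        using elim summable_rabs[of "\<lambda>n. p n * x n \<omega>"] by (simp add: infsum_nat_eq_suminf T_def)
      then have "(\<Sum>\<^sub>\<infinity>n. p n * x n \<omega>)\<^sup>2 \<le> T\<^sup>2"
        using power_mono[of "\<bar>\<Sum>\<^sub>\<infinity>n. p n * x n \<omega>\<bar>" T 2] by simp
      also have "T\<^sup>2 \<le> P * g"
      proof -
        \<comment> \<open>This proves a weighted Cauchy-Schwarz inequality: summing |p n| (|x n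
          \<omega>| - t)^2 \<ge> 0 gives a bound for every \<open>t\<close>, used below at the
          optimal \<open>t = T / P\<close>.\<close>
        have quad: "2 * t * T \<le> g + t\<^sup>2 * P" for t
        proof -
          have "2 * t * T = (\<Sum>n. 2 * t * \<bar>p n * x n \<omega>\<bar>)"
            unfolding T_def using elim(2) by (rule suminf_mult[symmetric])
          also have "\<dots> \<le> (\<Sum>n. \<bar>p n\<bar> * (x n \<omega>)\<^sup>2 + t\<^sup>2 * \<bar>p n\<bar>)"
          proof (rule suminf_le)
            show "2 * t * \<bar>p n * x n \<omega>\<bar> \<le> \<bar>p n\<bar> * (x n \<omega>)\<^sup>2 + t\<^sup>2 * \<bar>p n\<bar>" for n
              using mult_left_mono[OF sum_squares_bound[of "\<bar>x n \<omega>\<bar>" t], of "\<bar>p n\<bar>"]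
              by (simp add: abs_mult algebra_simps)
            show "summable (\<lambda>n. 2 * t * \<bar>p n * x n \<omega>\<bar>)"
              by (rule summable_mult[OF elim(2)])
            show "summable (\<lambda>n. \<bar>p n\<bar> * (x n \<omega>)\<^sup>2 + t\<^sup>2 * \<bar>p n\<bar>)"
              by (rule summable_add[OF elim(1) summable_mult[OF p]])
          qed
          also have "\<dots> = g + t\<^sup>2 * (\<Sum>n. \<bar>p n\<bar>)"
            using suminf_add[OF elim(1) summable_mult[OF p, of "t\<^sup>2"]] suminf_mult[OF p, of "t\<^sup>2"]
            by (simp add: g_def)
          also have "\<dots> \<le> g + t\<^sup>2 * P"
            by (simp add: P_def distrib_left)
          finally show ?thesis .
        qed
        have "P > 0"
          using suminf_nonneg[OF p] by (simp add: P_def)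
        have "2 * (T\<^sup>2 / P) \<le> g + T\<^sup>2 / P"
          using quad[of "T / P"] \<open>P > 0\<close> by (simp add: power2_eq_square)
        then have "T\<^sup>2 / P \<le> g" by simp
        then show ?thesis using \<open>P > 0\<close> by (simp add: pos_divide_le_eq mult.commute)
      qed
      finally show ?case by (simp add: g_def)
    qed
  qed simp
  show ?exp if v: "sqint M v"
  proof -
    have [measurable]: "v \<in> borel_measurable M" and iv: "integrable M (\<lambda>\<omega>. (v \<omega>)\<^sup>2)"
      using v by (simp_all add: sqint_def)
    define C where "C = B + expectation (\<lambda>\<omega>. (v \<omega>)\<^sup>2)"
    have bound: "expectation (\<lambda>\<omega>. \<bar>x n \<omega> * v \<omega>\<bar>) \<le> C" for n
    proof -
      have "expectation (\<lambda>\<omega>. \<bar>x n \<omega> * v \<omega>\<bar>) \<le> expectation (\<lambda>\<omega>. (x n \<omega>)\<^sup>2 + (v \<omega>)\<^sup>2)"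
        using ix iv sqint_integrable_mult[OF x v] by (intro integral_mono abs_mult_le_sum_squares) auto
      then show ?thesis using B[of n] ix iv by (simp add: C_def)
    qed
    have int: "integrable M (\<lambda>\<omega>. p n * (x n \<omega> * v \<omega>))" for n
      using sqint_integrable_mult[OF x v] by simp
    have s: "summable (\<lambda>n. \<integral>\<omega>. norm (p n * (x n \<omega> * v \<omega>)) \<partial>M)"
    proof (rule summable_comparison_test'[OF pB[of C], of 0])
      have "norm (p n * (x n \<omega> * v \<omega>)) = \<bar>p n\<bar> * \<bar>x n \<omega> * v \<omega>\<bar>" for n \<omega>
        by (simp add: abs_mult)
      then show "norm (\<integral>\<omega>. norm (p n * (x n \<omega> * v \<omega>)) \<partial>M) \<le> \<bar>p n\<bar> * C" for n
        using mult_left_mono[OF bound[of n], of "\<bar>p n\<bar>"] by (simp add: abs_mult integral_nonneg_AE)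
    qed
    have AEs: "AE \<omega> in M. summable (\<lambda>n. norm (p n * (x n \<omega> * v \<omega>)))"
      using sum
    proof eventually_elim
      case (elim \<omega>)
      from summable_mult2[OF this, of "\<bar>v \<omega>\<bar>"] show ?case by (simp add: abs_mult mult.assoc)
    qed
    have "(\<lambda>n. expectation (\<lambda>\<omega>. p n * (x n \<omega> * v \<omega>))) sums expectation (\<lambda>\<omega>. \<Sum>n. p n * (x n \<omega> * v \<omega>))"
      using int AEs s by (rule sums_integral)
    \<comment> \<open>Where the series converges absolutely, hence almost surely,
      \<open>infsum\<close> and \<open>suminf\<close> agree.\<close>
    moreover have "expectation (\<lambda>\<omega>. \<Sum>n. p n * (x n \<omega> * v \<omega>)) = expectation (\<lambda>\<omega>. (\<Sum>\<^sub>\<infinity>n. p n * x n \<omega>) * v \<omega>)"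
    proof (rule integral_cong_AE)
      show "AE \<omega> in M. (\<Sum>n. p n * (x n \<omega> * v \<omega>)) = (\<Sum>\<^sub>\<infinity>n. p n * x n \<omega>) * v \<omega>"
        using sum
      proof eventually_elim
        case (elim \<omega>)
        then show ?case
          using suminf_mult2[of "\<lambda>n. p n * x n \<omega>" "v \<omega>"]
          by (simp add: infsum_nat_eq_suminf summable_rabs_cancel mult.assoc)
      qed
    qed measurable
    moreover have "summable (\<lambda>n. norm (p n * expectation (\<lambda>\<omega>. x n \<omega> * v \<omega>)))"
    proof (rule summable_comparison_test'[OF s, of 0])
      show "norm (norm (p n * expectation (\<lambda>\<omega>. x n \<omega> * v \<omega>))) \<le> (\<integral>\<omega>. norm (p n * (x n \<omega> * v \<omega>)) \<partial>M)" for n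
        using integral_norm_bound[of M "\<lambda>\<omega>. p n * (x n \<omega> * v \<omega>)"] by simp
    qed
    ultimately show ?thesis
      by (intro norm_summable_imp_has_sum) simp_all
  qed
qed

lemma sqint_series:
  fixes p :: "int \<Rightarrow> real" and x :: "int \<Rightarrow> 'a \<Rightarrow> real"
  assumes p: "(\<lambda>k. \<bar>p k\<bar>) summable_on UNIV"
    and x: "\<And>k. sqint M (x k)" and B: "\<And>k. expectation (\<lambda>\<omega>. (x k \<omega>)\<^sup>2) \<le> B"
  shows "AE \<omega> in M. (\<lambda>k. p k * x k \<omega>) summable_on UNIV"
    and "sqint M (\<lambda>\<omega>. \<Sum>\<^sub>\<infinity>k. p k * x k \<omega>)"
    and "sqint M v \<Longrightarrow> ((\<lambda>k. p k * expectation (\<lambda>\<omega>. x k \<omega> * v \<omega>)) has_sum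
      expectation (\<lambda>\<omega>. (\<Sum>\<^sub>\<infinity>k. p k * x k \<omega>) * v \<omega>)) UNIV"
proof -
  have "(\<lambda>n. \<bar>p (int_decode n)\<bar>) summable_on UNIV"
    using p summable_on_reindex_bij_betw[OF bij_int_decode, of "\<lambda>k. \<bar>p k\<bar>"] by simp
  then have p': "summable (\<lambda>n. \<bar>p (int_decode n)\<bar>)"
    by (rule summable_on_imp_summable)
  note * = sqint_series_nat[where p = "\<lambda>n. p (int_decode n)" and x = "\<lambda>n. x (int_decode n)", OF p' x B]
  show "AE \<omega> in M. (\<lambda>k. p k * x k \<omega>) summable_on UNIV"
    using *(1)
  proof eventually_elim
    case (elim \<omega>)
    then have "(\<lambda>n. p (int_decode n) * x (int_decode n) \<omega>) summable_on UNIV"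
      by (intro norm_summable_imp_summable_on) simp
    then show ?case
      using summable_on_reindex_bij_betw[OF bij_int_decode, of "\<lambda>k. p k * x k \<omega>"] by simp
  qed
  show "sqint M (\<lambda>\<omega>. \<Sum>\<^sub>\<infinity>k. p k * x k \<omega>)"
    using *(2) by (simp add: infsum_int_decode)
  show "((\<lambda>k. p k * expectation (\<lambda>\<omega>. x k \<omega> * v \<omega>)) has_sum
      expectation (\<lambda>\<omega>. (\<Sum>\<^sub>\<infinity>k. p k * x k \<omega>) * v \<omega>)) UNIV" if "sqint M v"
    using *(3)[OF that] has_sum_reindex_bij_betw[OF bij_int_decode, of "\<lambda>k. p k * expectation (\<lambda>\<omega>. x k \<omega> * v \<omega>)"]
    by (simp add: infsum_int_decode)
qed

end

section \<open>Second moments and spectra of filtered processes\<close>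

lemma fourier_eqD: "fourier p f \<Longrightarrow> fourier p g \<Longrightarrow> cmod z = 1 \<Longrightarrow> f z = g z"
  unfolding fourier_def by (blast intro: has_sum_unique)

lemma tf_coeff_0 [simp]: "tf_coeff 0 k = 0"
  using tf_coeff_unique[of 0 "\<lambda>_. 0" k] fourier_0 by (simp add: tf_F_closed fourier_def)

text \<open>Both series converge together, and otherwise both sums have the default value 0.\<close>

lemma infsum_of_real: "(\<Sum>\<^sub>\<infinity>k\<in>A. complex_of_real (f k)) = of_real (\<Sum>\<^sub>\<infinity>k\<in>A. f k)"
proof (cases "f summable_on A")
  case True
  then show ?thesis by (intro infsumI has_sum_of_real has_sum_infsum)
next
  case False
  moreover have "f summable_on A" if "(\<lambda>k. complex_of_real (f k)) summable_on A"
    using summable_on_Re[OF that] by simp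
  ultimately show ?thesis by (simp add: infsum_not_exists) (metis infsum_not_exists of_real_0)
qed

lemma fourier_tf_mult:
  assumes "r \<in> tf_F" "fourier (\<lambda>k. of_real (h k)) H"
  shows "fourier (\<lambda>n. of_real (\<Sum>\<^sub>\<infinity>k. tf_coeff r (n - k) * h k)) (\<lambda>z. tf_eval r z * H z)"
  using fourier_mult[OF fourier_tf_coeff[OF assms(1)] assms(2)]
  by (simp add: infsum_of_real flip: of_real_mult)

lemma fourier_tf_mult_sum:
  assumes "\<And>c. r c \<in> tf_F" "\<And>c. fourier (\<lambda>k. of_real (h c k)) (H c)"
  shows "fourier (\<lambda>n. of_real (\<Sum>c\<in>C. \<Sum>\<^sub>\<infinity>k. tf_coeff (r c) (n - k) * h c k)) (\<lambda>z. \<Sum>c\<in>C. tf_eval (r c) z * H c z)"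
  using fourier_sum[of C "\<lambda>c n. of_real (\<Sum>\<^sub>\<infinity>k. tf_coeff (r c) (n - k) * h c k)", OF fourier_tf_mult[OF assms]]
  by simp

lemma has_psd_fourier:
  "has_psd M x \<Phi> \<Longrightarrow> fourier (\<lambda>k. of_real (autocorr M x k $ a $ b)) (\<lambda>z. \<Phi> z $ a $ b)"
  by (simp add: has_psd_def fourier_def)

lemma wss_sqint: "zero_mean_wss M x \<Longrightarrow> sqint M (\<lambda>\<omega>. x t \<omega> $ a)"
  by (simp add: zero_mean_wss_def sqint_def)

lemma wss_autocorr:
  assumes "zero_mean_wss M x"
  shows "integral\<^sup>L M (\<lambda>\<omega>. x t \<omega> $ a * x s \<omega> $ b) = autocorr M x (t - s) $ a $ b"
proof -
  have "integral\<^sup>L M (\<lambda>\<omega>. x (s + (t - s)) \<omega> $ a * x s \<omega> $ b) =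
      integral\<^sup>L M (\<lambda>\<omega>. x (t - s) \<omega> $ a * x 0 \<omega> $ b)"
    using assms unfolding zero_mean_wss_def by blast
  then show ?thesis by (simp add: autocorr_def)
qed

context prob_space
begin

text \<open>Stationarity makes the second moments of \<open>x\<close> constant in time, the uniform
  bound that lets expectation and series be exchanged. Since \<open>v\<close> is any square
  integrable variable, correlations with noise, output or errors are all covered.\<close>

lemma tf_apply_expectation:
  assumes x: "zero_mean_wss M x" and P: "entries_in tf_F P"
  shows sqint_tf_apply: "sqint M (\<lambda>\<omega>. tf_apply P x t \<omega> $ a)"
    and expectation_tf_apply: "sqint M v \<Longrightarrow> expectation (\<lambda>\<omega>. tf_apply P x t \<omega> $ a * v \<omega>) =
      (\<Sum>b\<in>UNIV. \<Sum>\<^sub>\<infinity>k. tf_coeff (P $ a $ b) (t - k) * expectation (\<lambda>\<omega>. x k \<omega> $ b * v \<omega>))"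
    and AE_summable_tf_apply: "AE \<omega> in M. (\<lambda>k. tf_coeff (P $ a $ b) (t - k) * x k \<omega> $ b) summable_on UNIV"
proof -
  have Pab: "P $ a $ b \<in> tf_F" for b using P by (simp add: entries_in_def)
  have "bij (\<lambda>k. t - k)" for t :: int
    by (rule bij_betwI[of _ _ _ "\<lambda>k. t - k"]) auto
  then have s: "(\<lambda>k. \<bar>tf_coeff (P $ a $ b) (t - k)\<bar>) summable_on UNIV" for b
    using summable_on_reindex_bij_betw[of "\<lambda>k. t - k" UNIV UNIV "\<lambda>k. \<bar>tf_coeff (P $ a $ b) k\<bar>"]
      tf_coeff_summable[OF Pab] by simp
  have B: "expectation (\<lambda>\<omega>. (x k \<omega> $ b)\<^sup>2) \<le> autocorr M x 0 $ b $ b" for k b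
    using wss_autocorr[OF x, of k b k b] by (simp add: power2_eq_square)
  note ser = sqint_series[OF s wss_sqint[OF x] B]
  show "AE \<omega> in M. (\<lambda>k. tf_coeff (P $ a $ b) (t - k) * x k \<omega> $ b) summable_on UNIV"
    by (rule ser(1))
  show "sqint M (\<lambda>\<omega>. tf_apply P x t \<omega> $ a)"
    unfolding tf_apply_def vec_lambda_beta by (intro sqint_sum ser(2))
  show "expectation (\<lambda>\<omega>. tf_apply P x t \<omega> $ a * v \<omega>) =
      (\<Sum>b\<in>UNIV. \<Sum>\<^sub>\<infinity>k. tf_coeff (P $ a $ b) (t - k) * expectation (\<lambda>\<omega>. x k \<omega> $ b * v \<omega>))"
    if v: "sqint M v"
  proof -
    have "expectation (\<lambda>\<omega>. tf_apply P x t \<omega> $ a * v \<omega>) =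
        expectation (\<lambda>\<omega>. \<Sum>b\<in>UNIV. (\<Sum>\<^sub>\<infinity>k. tf_coeff (P $ a $ b) (t - k) * x k \<omega> $ b) * v \<omega>)"
      by (simp add: tf_apply_def sum_distrib_right)
    also have "\<dots> = (\<Sum>b\<in>UNIV. expectation (\<lambda>\<omega>. (\<Sum>\<^sub>\<infinity>k. tf_coeff (P $ a $ b) (t - k) * x k \<omega> $ b) * v \<omega>))"
      by (rule Bochner_Integration.integral_sum) (rule sqint_integrable_mult[OF ser(2) v])
    also have "\<dots> = (\<Sum>b\<in>UNIV. \<Sum>\<^sub>\<infinity>k. tf_coeff (P $ a $ b) (t - k) * expectation (\<lambda>\<omega>. x k \<omega> $ b * v \<omega>))"
      by (intro sum.cong refl infsumI[symmetric] ser(3) v)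
    finally show ?thesis .
  qed
qed

text \<open>With the second factor at time \<open>- n\<close> the lag is \<open>n\<close>, and
  substituting \<open>k - n\<close> for \<open>k\<close> gives the convolution the form found in
  \<open>fourier_mult\<close>.\<close>

lemma expectation_tf_apply_output:
  assumes x: "zero_mean_wss M x" and P: "entries_in tf_F P"
  shows "expectation (\<lambda>\<omega>. tf_apply P x 0 \<omega> $ a * x (- n) \<omega> $ b) =
    (\<Sum>c\<in>UNIV. \<Sum>\<^sub>\<infinity>k. tf_coeff (P $ a $ c) (n - k) * autocorr M x k $ c $ b)"
proof -
  have "bij (\<lambda>k :: int. k - n)"
    by (rule bij_betwI[of _ _ _ "\<lambda>k. k + n"]) auto
  then have "(\<Sum>\<^sub>\<infinity>k. tf_coeff (P $ a $ c) (0 - k) * autocorr M x (k - (- n)) $ c $ b) =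
      (\<Sum>\<^sub>\<infinity>k. tf_coeff (P $ a $ c) (n - k) * autocorr M x k $ c $ b)" for c
    by (subst infsum_reindex_bij_betw[symmetric, of "\<lambda>k. k - n" UNIV UNIV]) auto
  then show ?thesis
    by (simp only: expectation_tf_apply[OF x P wss_sqint[OF x]] wss_autocorr[OF x])
qed

lemma fourier_tf_apply_output:
  assumes "zero_mean_wss M x" "has_psd M x \<Phi>" "entries_in tf_F P"
  shows "fourier (\<lambda>n. of_real (expectation (\<lambda>\<omega>. tf_apply P x 0 \<omega> $ a * x (- n) \<omega> $ b)))
    (\<lambda>z. \<Sum>c\<in>UNIV. tf_eval (P $ a $ c) z * \<Phi> z $ c $ b)"
  unfolding expectation_tf_apply_output[OF assms(1,3)]
  using assms(3) by (intro fourier_tf_mult_sum has_psd_fourier assms(2)) (simp add: entries_in_def)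

section \<open>Normal equations of the Wiener filter\<close>

text \<open>Equality is almost sure because splitting the series requires the unperturbed one to
  converge.\<close>

lemma tf_apply_perturb:
  fixes P :: "tf ^ 'b::finite ^ 'c::finite"
  assumes x: "zero_mean_wss M x" and P: "entries_in tf_F P"
    and P'_def: "P' = (\<chi> i j. P $ i $ j + (if i = a \<and> j = b then tf_shift c m else 0))"
  shows "entries_in tf_F P'"
    and "AE \<omega> in M. tf_apply P' x 0 \<omega> = tf_apply P x 0 \<omega> + axis a (c * x (- m) \<omega> $ b)"
proof -
  show "entries_in tf_F P'"
    using P by (auto simp: entries_in_def P'_def intro!: tf_F_closed tf_shift_in_F)
  have Pab: "P $ a $ b \<in> tf_F" using P by (simp add: entries_in_def)
  show "AE \<omega> in M. tf_apply P' x 0 \<omega> = tf_apply P x 0 \<omega> + axis a (c * x (- m) \<omega> $ b)"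
    using AE_summable_tf_apply[OF x P, of a b 0]
  proof eventually_elim
    case (elim \<omega>)
    have one: "((\<lambda>k. if k = - m then c * x k \<omega> $ b else 0) has_sum c * x (- m) \<omega> $ b) UNIV"
      by (rule has_sum_finite_neutralI[of "{- m}"]) auto
    have "tf_coeff (P' $ a $ b) (0 - k) * x k \<omega> $ b =
        tf_coeff (P $ a $ b) (0 - k) * x k \<omega> $ b + (if k = - m then c * x k \<omega> $ b else 0)" for k
      using tf_coeff_add_shift[OF Pab, of c m "- k"] by (auto simp: P'_def algebra_simps)
    then have "(\<Sum>\<^sub>\<infinity>k. tf_coeff (P' $ a $ b) (0 - k) * x k \<omega> $ b) =
        (\<Sum>\<^sub>\<infinity>k. tf_coeff (P $ a $ b) (0 - k) * x k \<omega> $ b) + c * x (- m) \<omega> $ b"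
      using infsumI[OF has_sum_add[OF has_sum_infsum[OF elim] one]] by simp
    then have "(\<Sum>\<^sub>\<infinity>k. tf_coeff (P' $ i $ j) (0 - k) * x k \<omega> $ j) =
        (\<Sum>\<^sub>\<infinity>k. tf_coeff (P $ i $ j) (0 - k) * x k \<omega> $ j) +
        (if i = a \<and> j = b then c * x (- m) \<omega> $ b else 0)" for i j
      by (auto simp: P'_def)
    then have "tf_apply P' x 0 \<omega> $ i = tf_apply P x 0 \<omega> $ i + (if i = a then c * x (- m) \<omega> $ b else 0)" for i
      by (simp add: tf_apply_def sum.distrib)
    then show ?case by (simp add: vec_eq_iff axis_def)
  qed
qed

text \<open>Perturbing one entry of the filter by \<open>c z\<^sup>-\<^sup>m\<close> changes the cost by \<open>- 2 c A + c\<^sup>2 B\<close>, where \<open>A\<close> is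
  the correlation of the error with the regressor.\<close>

lemma wiener_filter_orthogonal:
  assumes x: "\<And>a. sqint M (\<lambda>\<omega>. x 0 \<omega> $ a)" and y: "zero_mean_wss M y"
    and W: "wiener_filter M x y W"
  shows "expectation (\<lambda>\<omega>. x 0 \<omega> $ a * y n \<omega> $ b) = expectation (\<lambda>\<omega>. tf_apply W y 0 \<omega> $ a * y n \<omega> $ b)"
proof -
  have WF: "entries_in tf_F W" using W by (simp add: wiener_filter_def)
  define d where "d i \<omega> = x 0 \<omega> $ i - tf_apply W y 0 \<omega> $ i" for i \<omega>
  have d: "sqint M (d i)" for i
    unfolding d_def by (intro sqint_diff x sqint_tf_apply[OF y WF])
  have yb: "sqint M (\<lambda>\<omega>. y n \<omega> $ b)" by (rule wss_sqint[OF y])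
  define A where "A = expectation (\<lambda>\<omega>. d a \<omega> * y n \<omega> $ b)"
  define B where "B = expectation (\<lambda>\<omega>. (y n \<omega> $ b)\<^sup>2)"
  have int: "integrable M (\<lambda>\<omega>. \<Sum>i\<in>UNIV. (d i \<omega>)\<^sup>2)" "integrable M (\<lambda>\<omega>. d a \<omega> * y n \<omega> $ b)"
    "integrable M (\<lambda>\<omega>. (y n \<omega> $ b)\<^sup>2)"
    using d yb sqint_integrable_mult[OF d yb] by (auto simp: sqint_def)
  have cost: "0 \<le> - 2 * c * A + c\<^sup>2 * B" for c
  proof -
    \<comment> \<open>The lag \<open>- n\<close> makes the perturbation at time 0 read
      \<open>y\<close> at time \<open>n\<close>.\<close>
    define W' where "W' = (\<chi> i j. W $ i $ j + (if i = a \<and> j = b then tf_shift c (- n) else 0))"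
    note W' = tf_apply_perturb[OF y WF W'_def]
    have "tf_apply W' y \<in> tfspan y" using W'(1) by (auto simp: tfspan_def)
    then have "expectation (\<lambda>\<omega>. (x 0 \<omega> - tf_apply W y 0 \<omega>) \<bullet> (x 0 \<omega> - tf_apply W y 0 \<omega>)) \<le>
        expectation (\<lambda>\<omega>. (x 0 \<omega> - tf_apply W' y 0 \<omega>) \<bullet> (x 0 \<omega> - tf_apply W' y 0 \<omega>))"
      using W by (auto simp: wiener_filter_def is_arg_min_def not_less)
    also have "expectation (\<lambda>\<omega>. (x 0 \<omega> - tf_apply W y 0 \<omega>) \<bullet> (x 0 \<omega> - tf_apply W y 0 \<omega>)) =
        expectation (\<lambda>\<omega>. \<Sum>i\<in>UNIV. (d i \<omega>)\<^sup>2)"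
      by (simp add: inner_vec_def d_def power2_eq_square)
    also have "expectation (\<lambda>\<omega>. (x 0 \<omega> - tf_apply W' y 0 \<omega>) \<bullet> (x 0 \<omega> - tf_apply W' y 0 \<omega>)) =
        expectation (\<lambda>\<omega>. (\<Sum>i\<in>UNIV. (d i \<omega>)\<^sup>2) + (- 2 * c * (d a \<omega> * y n \<omega> $ b) + c\<^sup>2 * (y n \<omega> $ b)\<^sup>2))"
    proof (rule integral_cong_AE)
      show "AE \<omega> in M. (x 0 \<omega> - tf_apply W' y 0 \<omega>) \<bullet> (x 0 \<omega> - tf_apply W' y 0 \<omega>) =
        (\<Sum>i\<in>UNIV. (d i \<omega>)\<^sup>2) + (- 2 * c * (d a \<omega> * y n \<omega> $ b) + c\<^sup>2 * (y n \<omega> $ b)\<^sup>2)"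
        using W'(2)
      proof eventually_elim
        case (elim \<omega>)
        have "(x 0 \<omega> - tf_apply W' y 0 \<omega>) \<bullet> (x 0 \<omega> - tf_apply W' y 0 \<omega>) =
            (\<Sum>i\<in>UNIV. (d i \<omega> - (if i = a then c * y n \<omega> $ b else 0))\<^sup>2)"
          by (simp add: elim inner_vec_def d_def power2_eq_square axis_def algebra_simps)
        also have "\<dots> = (\<Sum>i\<in>UNIV. (d i \<omega>)\<^sup>2 +
            (if i = a then - 2 * c * (d a \<omega> * y n \<omega> $ b) + c\<^sup>2 * (y n \<omega> $ b)\<^sup>2 else 0))"
          by (intro sum.cong) (auto simp: power2_eq_square algebra_simps)
        finally show ?case by (simp add: sum.distrib)
      qed
      have "sqint M (\<lambda>\<omega>. tf_apply W' y 0 \<omega> $ i)" for i by (rule sqint_tf_apply[OF y W'(1)])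
      then show "(\<lambda>\<omega>. (x 0 \<omega> - tf_apply W' y 0 \<omega>) \<bullet> (x 0 \<omega> - tf_apply W' y 0 \<omega>)) \<in> borel_measurable M"
        using x unfolding inner_vec_def sqint_def inner_real_def vector_minus_component
        by (intro borel_measurable_sum borel_measurable_times borel_measurable_diff) auto
      show "(\<lambda>\<omega>. (\<Sum>i\<in>UNIV. (d i \<omega>)\<^sup>2) + (- 2 * c * (d a \<omega> * y n \<omega> $ b) + c\<^sup>2 * (y n \<omega> $ b)\<^sup>2)) \<in> borel_measurable M"
        using int by (intro borel_measurable_add) auto
    qed
    also have "\<dots> = expectation (\<lambda>\<omega>. \<Sum>i\<in>UNIV. (d i \<omega>)\<^sup>2) + (- 2 * c * A + c\<^sup>2 * B)"
      using int by (simp add: A_def B_def del: Bochner_Integration.integral_sum)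
    finally show ?thesis by simp
  qed
  have "B \<ge> 0" by (simp add: B_def)
  have "A = 0"
  proof (rule ccontr)
    assume "A \<noteq> 0"
    \<comment> \<open>Every small nonzero \<open>c\<close> with the sign of \<open>A\<close> makes
      the change of cost negative. With this one it is \<open>- (c\<^sup>2 * (B + 2))\<close>, and
      the summand 1 covers \<open>B = 0\<close>.\<close>
    define c where "c = A / (B + 1)"
    have A: "A = c * (B + 1)" and "c \<noteq> 0" using \<open>B \<ge> 0\<close> \<open>A \<noteq> 0\<close> by (auto simp: c_def)
    have "- 2 * c * A + c\<^sup>2 * B = - (c\<^sup>2 * (B + 2))" by (simp add: A power2_eq_square algebra_simps)
    moreover have "c\<^sup>2 * (B + 2) > 0" using \<open>c \<noteq> 0\<close> \<open>B \<ge> 0\<close> by simp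
    ultimately show False using cost[of c] by simp
  qed
  then show ?thesis
    using sqint_integrable_mult[OF x yb] sqint_integrable_mult[OF sqint_tf_apply[OF y WF] yb]
    by (simp add: A_def d_def left_diff_distrib)
qed

text \<open>Orthogonality at all lags, transformed to the circle, is the normal equation Phi_xx' = W
  Phi_x'x'. The maps \<rho> and \<sigma> locate the estimated and the observed coordinates inside
  \<open>y\<close>, so that all spectra are read off the one density \<Phi>.\<close>

lemma wiener_filter_psd:
  assumes y: "zero_mean_wss M y" and psd: "has_psd M y \<Phi>"
    and x: "\<And>t \<omega> a. x t \<omega> $ a = y t \<omega> $ \<rho> a" and x': "\<And>t \<omega> b. x' t \<omega> $ b = y t \<omega> $ \<sigma> b"
    and W: "wiener_filter M x x' W" and z: "cmod z = 1"
  shows "\<Phi> z $ \<rho> a $ \<sigma> b = (\<Sum>c\<in>UNIV. tf_eval (W $ a $ c) z * \<Phi> z $ \<sigma> c $ \<sigma> b)"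
proof -
  have wss': "zero_mean_wss M x'" using y unfolding zero_mean_wss_def x' by blast
  have "autocorr M x' k $ b $ c = autocorr M y k $ \<sigma> b $ \<sigma> c" for k b c
    by (simp add: autocorr_def x')
  then have psd': "has_psd M x' (\<lambda>z. \<chi> b c. \<Phi> z $ \<sigma> b $ \<sigma> c)"
    using psd by (simp add: has_psd_def)
  have WF: "entries_in tf_F W" using W by (simp add: wiener_filter_def)
  have "expectation (\<lambda>\<omega>. tf_apply W x' 0 \<omega> $ a * x' (- n) \<omega> $ b) = autocorr M y n $ \<rho> a $ \<sigma> b" for n
    using wiener_filter_orthogonal[OF _ wss' W, of a "- n" b] wss_sqint[OF y] wss_autocorr[OF y, of 0 "\<rho> a" "- n" "\<sigma> b"]
    by (simp add: x x')
  then have "fourier (\<lambda>n. of_real (autocorr M y n $ \<rho> a $ \<sigma> b)) (\<lambda>z. \<Sum>c\<in>UNIV. tf_eval (W $ a $ c) z * \<Phi> z $ \<sigma> c $ \<sigma> b)"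
    using fourier_tf_apply_output[OF wss' psd' WF, of a b] by simp
  from fourier_eqD[OF has_psd_fourier[OF psd] this z] show ?thesis .
qed

end

section \<open>The spectral density of the output\<close>

definition hadj :: "complex ^ 'n ^ 'm \<Rightarrow> complex ^ 'm ^ 'n" where
  "hadj A = (\<chi> i j. cnj (A $ j $ i))"

context prob_space
begin

lemma expectation_AE_cong_mult:
  assumes "sqint M f" "sqint M g" "sqint M v" "AE \<omega> in M. f \<omega> = g \<omega>"
  shows "expectation (\<lambda>\<omega>. f \<omega> * v \<omega>) = expectation (\<lambda>\<omega>. g \<omega> * v \<omega>)"
  using assms
  by (intro integral_cong_AE borel_measurable_times) (auto simp: sqint_def)

text \<open>Each error coordinate is filtered from noise coordinates of its own node, and distinct
  coordinates of white noise are uncorrelated at all lags. The filters are expanded one at a time: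
  \<open>e\<close> at \<open>b\<close> against \<open>u\<close>, then \<open>e\<close> at
  \<open>a\<close> against \<open>e\<close> at \<open>b\<close>.\<close>

lemma ldim_error_uncorrelated:
  assumes ldim: "ldim M nd Q nu P u e" and ab: "nd a \<noteq> nd b"
  shows "expectation (\<lambda>\<omega>. e t \<omega> $ a * e s \<omega> $ b) = 0"
proof -
  have u: "zero_mean_wss M u" and e: "zero_mean_wss M e" and P: "entries_in tf_F P"
    and P0: "\<And>a b. nd a \<noteq> nu b \<Longrightarrow> P $ a $ b = 0"
    and psd: "has_psd M u (\<lambda>z. mat 1)" and eP: "AE \<omega> in M. e t \<omega> = tf_apply P u t \<omega>" for t
    using ldim by (auto simp: ldim_def entries_in_def tf_F_causal_def proc_eq_def)
  \<comment> \<open>Uniqueness of the coefficients turns a zero entry of the spectrum into vanishing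
    correlations.\<close>
  have white: "autocorr M u k $ c $ d = 0" if "c \<noteq> d" for k c d
  proof -
    have "fourier (\<lambda>k. of_real (autocorr M u k $ c $ d)) (\<lambda>z. 0)"
      using has_psd_fourier[OF psd, of c d] that by (simp add: mat_def)
    from fun_cong[OF fourier_unique[OF this fourier_0], of k] show ?thesis by simp
  qed
  have expand: "expectation (\<lambda>\<omega>. e t \<omega> $ a * v \<omega>) =
      (\<Sum>c\<in>UNIV. \<Sum>\<^sub>\<infinity>k. tf_coeff (P $ a $ c) (t - k) * expectation (\<lambda>\<omega>. u k \<omega> $ c * v \<omega>))"
    if "sqint M v" for t a v
  proof -
    have "AE \<omega> in M. e t \<omega> $ a = tf_apply P u t \<omega> $ a" using eP[of t] by eventually_elim simp
    then have "expectation (\<lambda>\<omega>. e t \<omega> $ a * v \<omega>) = expectation (\<lambda>\<omega>. tf_apply P u t \<omega> $ a * v \<omega>)"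
      by (intro expectation_AE_cong_mult wss_sqint[OF e] sqint_tf_apply[OF u P] that)
    then show ?thesis by (simp add: expectation_tf_apply[OF u P that])
  qed
  have "expectation (\<lambda>\<omega>. e s \<omega> $ b * u k \<omega> $ c) = 0" if "nu c \<noteq> nd b" for k c
  proof -
    have "tf_coeff (P $ b $ d) (s - l) * expectation (\<lambda>\<omega>. u l \<omega> $ d * u k \<omega> $ c) = 0" for d l
      using that white[of d c] P0[of b d] by (cases "nu d = nd b") (auto simp: wss_autocorr[OF u])
    then show ?thesis by (simp only: expand[OF wss_sqint[OF u]] infsum_0_simp sum.neutral_const)
  qed
  then have "tf_coeff (P $ a $ c) (t - k) * expectation (\<lambda>\<omega>. u k \<omega> $ c * e s \<omega> $ b) = 0" for c k
    using P0[of a c] ab by (cases "nd a = nu c") (auto simp: mult.commute)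
  then show ?thesis by (simp only: expand[OF wss_sqint[OF e]] infsum_0_simp sum.neutral_const)
qed

text \<open>The matrix is the spectrum Psi of e = (I - Q) y, with I - Q applied to one factor of the
  correlation after the other; its entry at \<open>a\<close>, \<open>b\<close> is the transform of
  the correlation of two uncorrelated errors.\<close>

lemma ldim_psd_off_diagonal:
  fixes Q :: "tf ^ 'c::finite ^ 'c"
  assumes ldim: "ldim M nd Q nu P u e" and out: "ldim_output M Q e y"
    and psd: "has_psd M y \<Phi>" and ab: "nd a \<noteq> nd b" and z: "cmod z = 1"
  defines "A \<equiv> mat 1 - (\<chi> a b. tf_eval (Q $ a $ b) z)"
  shows "(A ** \<Phi> z ** hadj A) $ a $ b = 0"
proof -
  have e: "zero_mean_wss M e" and Q: "entries_in tf_F Q" and y: "zero_mean_wss M y"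
    and ye: "AE \<omega> in M. y t \<omega> = tf_apply Q y t \<omega> + e t \<omega>" for t
    using ldim out by (auto simp: ldim_def ldim_output_def proc_eq_def)
  note sq = wss_sqint[OF e] wss_sqint[OF y] sqint_tf_apply[OF y Q]
  have e_eq: "expectation (\<lambda>\<omega>. e t \<omega> $ a * v \<omega>) =
      expectation (\<lambda>\<omega>. y t \<omega> $ a * v \<omega>) - expectation (\<lambda>\<omega>. tf_apply Q y t \<omega> $ a * v \<omega>)"
    if "sqint M v" for t a v
  proof -
    have "AE \<omega> in M. e t \<omega> $ a = y t \<omega> $ a - tf_apply Q y t \<omega> $ a"
      using ye[of t] by eventually_elim simp
    then have "expectation (\<lambda>\<omega>. e t \<omega> $ a * v \<omega>) = expectation (\<lambda>\<omega>. (y t \<omega> $ a - tf_apply Q y t \<omega> $ a) * v \<omega>)"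
      by (intro expectation_AE_cong_mult sqint_diff sq that)
    then show ?thesis
      using sqint_integrable_mult[OF sq(2) that] sqint_integrable_mult[OF sq(3) that]
      by (simp add: left_diff_distrib)
  qed
  \<comment> \<open>\<open>G\<close> correlates \<open>e\<close> at \<open>a\<close> with the
    output; its transform \<open>\<Gamma>\<close> is row \<open>a\<close> of
    \<open>A ** \<Phi> z\<close>.\<close>
  define G where "G c n = expectation (\<lambda>\<omega>. e 0 \<omega> $ a * y (- n) \<omega> $ c)" for c n
  define \<Gamma> where "\<Gamma> c z = \<Phi> z $ a $ c - (\<Sum>d\<in>UNIV. tf_eval (Q $ a $ d) z * \<Phi> z $ d $ c)" for c z
  have "G c n = autocorr M y n $ a $ c - expectation (\<lambda>\<omega>. tf_apply Q y 0 \<omega> $ a * y (- n) \<omega> $ c)" for c n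
    by (simp add: G_def e_eq sq wss_autocorr[OF y])
  then have G: "fourier (\<lambda>n. of_real (G c n)) (\<Gamma> c)" for c
    using fourier_diff[OF has_psd_fourier[OF psd, of a c] fourier_tf_apply_output[OF y psd Q, of a c]]
    unfolding \<Gamma>_def by simp
  \<comment> \<open>The error at \<open>b\<close> stands in the first factor, where the filter
    \<open>Q\<close> can be expanded; the price is that the lag of \<open>G\<close> is
    reversed.\<close>
  define H where "H n = expectation (\<lambda>\<omega>. e n \<omega> $ b * e 0 \<omega> $ a)" for n
  have "H n = G b (- n) - (\<Sum>c\<in>UNIV. \<Sum>\<^sub>\<infinity>k. tf_coeff (Q $ b $ c) (n - k) * G c (- k))" for n
    by (simp add: H_def G_def e_eq[of _ n b] sq expectation_tf_apply[OF y Q] mult.commute[of "y _ _ $ _"])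
  then have "fourier (\<lambda>n. of_real (H n)) (\<lambda>z. \<Gamma> b (cnj z) - (\<Sum>c\<in>UNIV. tf_eval (Q $ b $ c) z * \<Gamma> c (cnj z)))"
    using fourier_diff[OF fourier_reflect[OF G[of b]]
        fourier_tf_mult_sum[of "\<lambda>c. Q $ b $ c" "\<lambda>c n. G c (- n)", OF _ fourier_reflect[OF G]]] Q
    by (simp add: entries_in_def)
  moreover have "H n = 0" for n
    unfolding H_def using ab by (intro ldim_error_uncorrelated[OF ldim]) auto
  ultimately have "fourier (\<lambda>n. 0) (\<lambda>z. \<Gamma> b (cnj z) - (\<Sum>c\<in>UNIV. tf_eval (Q $ b $ c) z * \<Gamma> c (cnj z)))"
    by simp
  \<comment> \<open>Evaluation at \<open>cnj z\<close> undoes the reversal and conjugates the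
    entries of \<open>Q\<close>, which yields the factor \<open>hadj A\<close>.\<close>
  from fourier_eqD[OF this fourier_0, of "cnj z"] z
  have 0: "\<Gamma> b z - (\<Sum>c\<in>UNIV. cnj (tf_eval (Q $ b $ c) z) * \<Gamma> c z) = 0"
    by (simp add: tf_eval_cnj)
  have "(mat 1 ** \<Phi> z) $ a $ c - ((\<chi> a b. tf_eval (Q $ a $ b) z) ** \<Phi> z) $ a $ c = \<Gamma> c z" for c
    by (simp add: \<Gamma>_def matrix_matrix_mult_def[of "\<chi> a b. _ a b"])
  then have "(A ** \<Phi> z) $ a $ c = \<Gamma> c z" for c
    by (simp add: A_def matrix_matrix_mult_def left_diff_distrib sum_subtractf)
  then have "(A ** \<Phi> z ** hadj A) $ a $ b = (\<Sum>c\<in>UNIV. \<Gamma> c z * cnj (A $ b $ c))"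
    by (simp add: matrix_matrix_mult_def[of "A ** \<Phi> z"] hadj_def)
  also have "\<dots> = (\<Sum>c\<in>UNIV. (if c = b then \<Gamma> c z else 0) - cnj (tf_eval (Q $ b $ c) z) * \<Gamma> c z)"
    by (intro sum.cong) (auto simp: A_def mat_def algebra_simps)
  also have "\<dots> = 0" using 0 by (simp add: sum_subtractf)
  finally show ?thesis .
qed

end

section \<open>Estimating one node from all others\<close>

text \<open>In the column convention of \<open>hermitian_pos_def\<close>, the vanishing sum is the
  quadratic form at the conjugate of \<open>w\<close>.\<close>

lemma hermitian_pos_def_row:
  assumes "hermitian_pos_def \<Phi>" "(\<Sum>b\<in>UNIV. (w v* \<Phi>) $ b * cnj (w $ b)) = 0"
  shows "w = 0"
proof (rule ccontr)
  assume "w \<noteq> 0"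
  define v where "v = (\<chi> a. cnj (w $ a))"
  have "v \<noteq> 0" using \<open>w \<noteq> 0\<close> by (auto simp: v_def vec_eq_iff)
  then have "0 < Re (\<Sum>a\<in>UNIV. \<Sum>b\<in>UNIV. cnj (v $ a) * \<Phi> $ a $ b * v $ b)"
    using assms(1) unfolding hermitian_pos_def_def by blast
  also have "(\<Sum>a\<in>UNIV. \<Sum>b\<in>UNIV. cnj (v $ a) * \<Phi> $ a $ b * v $ b) =
      (\<Sum>b\<in>UNIV. (w v* \<Phi>) $ b * cnj (w $ b))"
    by (subst sum.swap) (simp add: v_def vector_matrix_mult_def sum_distrib_left sum_distrib_right mult_ac)
  finally show False using assms(2) by simp
qed

lemma sum_row_hadj:
  fixes A :: "complex ^ 'n::finite ^ 'm::finite"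
  shows "(\<Sum>d\<in>UNIV. (u v* hadj A) $ d * cnj (w $ d)) = (\<Sum>b\<in>UNIV. u $ b * cnj ((w v* A) $ b))"
proof -
  have "(\<Sum>d\<in>UNIV. (u v* hadj A) $ d * cnj (w $ d)) = (\<Sum>d\<in>UNIV. \<Sum>b\<in>UNIV. cnj (A $ d $ b) * u $ b * cnj (w $ d))"
    by (simp add: vector_matrix_mult_def hadj_def sum_distrib_left sum_distrib_right mult_ac)
  also have "\<dots> = (\<Sum>b\<in>UNIV. \<Sum>d\<in>UNIV. cnj (A $ d $ b) * u $ b * cnj (w $ d))"
    by (rule sum.swap)
  also have "\<dots> = (\<Sum>b\<in>UNIV. u $ b * cnj ((w v* A) $ b))"
    by (simp add: vector_matrix_mult_def sum_distrib_left mult_ac)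
  finally show ?thesis .
qed

text \<open>Cutting \<open>w\<close> down to the block \<beta> leaves its product with the block
  diagonal matrix unchanged on that block, so the quadratic form of that matrix vanishes at the cut
  row w'. By congruence this is the form of \<Phi> at w' A; hence w' A = 0, and w' = 0 because
  \<open>A\<close> is invertible.\<close>

lemma block_diagonal_row_zero:
  fixes A :: "complex ^ 'c::finite ^ 'c"
  assumes \<Phi>: "hermitian_pos_def \<Phi>" and R: "A ** R = mat 1"
    and diag: "\<And>a b. nd a \<noteq> nd b \<Longrightarrow> (A ** \<Phi> ** hadj A) $ a $ b = 0"
    and w: "\<And>d. nd d = \<beta> \<Longrightarrow> (w v* (A ** \<Phi> ** hadj A)) $ d = 0"
    and "nd d = \<beta>"
  shows "w $ d = 0"
proof -
  define \<Psi> where "\<Psi> = A ** \<Phi> ** hadj A"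
  define w' where "w' = (\<chi> d. if nd d = \<beta> then w $ d else 0)"
  have "(w' v* \<Psi>) $ d = (w v* \<Psi>) $ d" if "nd d = \<beta>" for d
    using that diag by (auto simp: vector_matrix_mult_def w'_def \<Psi>_def intro!: sum.cong)
  then have "(w' v* \<Psi>) $ d * cnj (w' $ d) = 0" for d
    using w by (auto simp: w'_def \<Psi>_def)
  then have "(\<Sum>d\<in>UNIV. (w' v* \<Psi>) $ d * cnj (w' $ d)) = 0" by (intro sum.neutral ballI)
  moreover have "w' v* \<Psi> = ((w' v* A) v* \<Phi>) v* hadj A"
    by (simp add: \<Psi>_def vector_matrix_mul_assoc)
  ultimately have "(\<Sum>b\<in>UNIV. ((w' v* A) v* \<Phi>) $ b * cnj ((w' v* A) $ b)) = 0"
    by (simp add: sum_row_hadj)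
  then have "w' v* A = 0"
    by (rule hermitian_pos_def_row[OF \<Phi>])
  then have "w' v* (A ** R) = 0"
    by (simp flip: vector_matrix_mul_assoc)
  then have "w' = 0" by (simp add: R)
  then have "w' $ d = 0" by simp
  then show ?thesis using \<open>nd d = \<beta>\<close> by (simp add: w'_def)
qed

text \<open>
  A row \<open>v\<close> with \<open>v \<Phi>\<close> supported on the block \<open>\<alpha>\<close> is a combination of the rows of
  \<open>\<Phi>\<^sup>-\<^sup>1 = (I - q)\<^sup>* \<Psi>\<^sup>-\<^sup>1 (I - q)\<close> in that block. Writing \<open>v = w (I - q)\<close>, the coefficients \<open>w\<close> live on \<open>\<alpha>\<close>
  and its children only.
\<close>

lemma row_supported_on_block:
  fixes q :: "complex ^ 'c::finite ^ 'c"
  assumes \<Phi>: "hermitian_pos_def \<Phi>" and R: "(mat 1 - q) ** R = mat 1"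
    and diag: "\<And>a b. nd a \<noteq> nd b \<Longrightarrow> ((mat 1 - q) ** \<Phi> ** hadj (mat 1 - q)) $ a $ b = 0"
    and edges: "\<And>c d. (nd d, nd c) \<notin> E \<Longrightarrow> q $ c $ d = 0"
    and loops: "(\<alpha>, \<alpha>) \<notin> E" "(\<beta>, \<beta>) \<notin> E" "(\<beta>, \<alpha>) \<notin> E"
    and child: "\<And>\<gamma>. (\<alpha>, \<gamma>) \<in> E \<Longrightarrow> \<gamma> = \<beta>" and "\<alpha> \<noteq> \<beta>"
    and v: "\<And>c. nd c \<noteq> \<alpha> \<Longrightarrow> (v v* \<Phi>) $ c = 0"
  defines "w \<equiv> \<lambda>d. v $ d + (\<Sum>h | nd h = \<beta>. v $ h * q $ h $ d)"
  shows "\<And>c. nd c = \<pi> \<Longrightarrow> \<pi> \<noteq> \<alpha> \<Longrightarrow> (\<pi>, \<beta>) \<notin> E \<Longrightarrow> \<pi> \<noteq> \<beta> \<Longrightarrow> v $ c = - (\<Sum>d | nd d = \<alpha>. w d * q $ d $ c)"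
    and "(\<And>d. nd d = \<alpha> \<Longrightarrow> w d = 0) \<Longrightarrow> v = 0"
proof -
  define A where "A = mat 1 - q"
  define \<Psi> where "\<Psi> = A ** \<Phi> ** hadj A"
  define u where "u = v v* R"
  have "R ** A = mat 1" using R matrix_left_right_inverse by (auto simp: A_def)
  then have v_eq: "v = u v* A"
    by (simp add: u_def vector_matrix_mul_assoc)
  have "u v* \<Psi> = (v v* \<Phi>) v* hadj A"
    unfolding \<Psi>_def v_eq by (simp add: vector_matrix_mul_assoc)
  moreover have "nd c = \<alpha>" if "(v v* \<Phi>) $ c \<noteq> 0" for c using that v by blast
  ultimately have u\<Psi>: "(u v* \<Psi>) $ d = (\<Sum>c | nd c = \<alpha>. (v v* \<Phi>) $ c * cnj (A $ d $ c))" for d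
    by (auto simp: vector_matrix_mult_def[of "v v* \<Phi>"] hadj_def mult.commute
        intro!: sum.mono_neutral_right)
  \<comment> \<open>The columns of \<alpha> in \<open>A\<close> live on the rows of \<alpha> and its
    child. By \<open>u\<Psi>\<close>, the row \<open>u v* \<Psi>\<close> is then zero on every other
    block, and definiteness passes this on to \<open>u\<close>.\<close>
  have A_out: "A $ d $ c = 0" if "nd c = \<alpha>" "nd d \<noteq> \<alpha>" "nd d \<noteq> \<beta>" for c d
    using that edges[of c d] child by (auto simp: A_def mat_def)
  have u0: "u $ d = 0" if "nd d \<noteq> \<alpha>" "nd d \<noteq> \<beta>" for d
    by (rule block_diagonal_row_zero[OF \<Phi>, of A R nd "nd d"])
       (use R diag that u\<Psi> A_out in \<open>auto simp: A_def \<Psi>_def\<close>)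
  have v_sum: "v $ c = u $ c - (\<Sum>d | nd d = \<alpha>. u $ d * q $ d $ c) - (\<Sum>d | nd d = \<beta>. u $ d * q $ d $ c)" for c
  proof -
    have "v $ c = (\<Sum>d\<in>UNIV. u $ d * (mat 1 $ d $ c) - u $ d * q $ d $ c)"
      by (subst v_eq) (simp add: vector_matrix_mult_def A_def algebra_simps)
    also have "\<dots> = u $ c - (\<Sum>d\<in>UNIV. u $ d * q $ d $ c)"
    proof -
      have "(\<Sum>d\<in>UNIV. u $ d * (mat 1 $ d $ c)) = (\<Sum>d\<in>UNIV. if d = c then u $ d else 0)"
        by (intro sum.cong) (auto simp: mat_def)
      then show ?thesis by (simp add: sum_subtractf)
    qed
    also have "(\<Sum>d\<in>UNIV. u $ d * q $ d $ c) = (\<Sum>d\<in>{d. nd d = \<alpha>} \<union> {d. nd d = \<beta>}. u $ d * q $ d $ c)"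
      using u0 by (intro sum.mono_neutral_right) auto
    also have "\<dots> = (\<Sum>d | nd d = \<alpha>. u $ d * q $ d $ c) + (\<Sum>d | nd d = \<beta>. u $ d * q $ d $ c)"
      using \<open>\<alpha> \<noteq> \<beta>\<close> by (intro sum.union_disjoint) auto
    finally show ?thesis by simp
  qed
  have q0: "(\<Sum>d | nd d = \<gamma>. u $ d * q $ d $ c) = 0" if "(nd c, \<gamma>) \<notin> E" for \<gamma> c
    using that edges by (intro sum.neutral) auto
  \<comment> \<open>No edge leads from \<beta> to \<alpha> or to \<beta>, so no correction term
    survives and \<open>u\<close> is \<open>v\<close> here. On \<alpha> the correction through the
    child remains, which makes \<open>u\<close> the expression \<open>w\<close>.\<close>
  have u\<beta>: "u $ c = v $ c" if "nd c = \<beta>" for c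
    using v_sum[of c] that loops q0 by simp
  have u\<alpha>: "u $ c = w c" if "nd c = \<alpha>" for c
  proof -
    have "(\<Sum>h | nd h = \<beta>. v $ h * q $ h $ c) = (\<Sum>h | nd h = \<beta>. u $ h * q $ h $ c)"
      using u\<beta> by (intro sum.cong) auto
    then show ?thesis using v_sum[of c] that loops q0 by (simp add: w_def)
  qed
  show "v $ c = - (\<Sum>d | nd d = \<alpha>. w d * q $ d $ c)"
    if "nd c = \<pi>" "\<pi> \<noteq> \<alpha>" "(\<pi>, \<beta>) \<notin> E" "\<pi> \<noteq> \<beta>" for c
  proof -
    have "(\<Sum>d | nd d = \<alpha>. w d * q $ d $ c) = (\<Sum>d | nd d = \<alpha>. u $ d * q $ d $ c)"
      using u\<alpha> by (intro sum.cong) auto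
    then show ?thesis using v_sum[of c] that q0 u0 by simp
  qed
  show "v = 0" if w0: "\<And>d. nd d = \<alpha> \<Longrightarrow> w d = 0"
  proof -
    \<comment> \<open>Without a loop at \<alpha>, the diagonal block of \<open>A\<close> at \<alpha>
      is the identity. The left side is zero on \<alpha> because \<open>u\<close> vanishes there and
      \<open>\<Psi>\<close> is block diagonal.\<close>
    have "(u v* \<Psi>) $ d = (v v* \<Phi>) $ d" if "nd d = \<alpha>" for d
    proof -
      have "A $ d $ c = (if c = d then 1 else 0)" if "nd c = \<alpha>" for c
        using edges[of c d] loops that \<open>nd d = \<alpha>\<close> by (auto simp: A_def mat_def)
      then have "(u v* \<Psi>) $ d = (\<Sum>c | nd c = \<alpha>. if c = d then (v v* \<Phi>) $ c else 0)"
        unfolding u\<Psi> by (intro sum.cong) auto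
      then show ?thesis using that by simp
    qed
    moreover have "(u v* \<Psi>) $ d = 0" if "nd d = \<alpha>" for d
    proof -
      have "u $ c * \<Psi> $ c $ d = 0" for c
        using w0[of c] u\<alpha>[of c] diag[of c d] that by (cases "nd c = \<alpha>") (auto simp: \<Psi>_def A_def)
      then show ?thesis by (auto simp: vector_matrix_mult_def intro!: sum.neutral)
    qed
    ultimately have "(v v* \<Phi>) $ d = 0" for d using v[of d] by (cases "nd d = \<alpha>") auto
    then have "v v* \<Phi> = 0" by (simp add: vec_eq_iff)
    then show ?thesis by (intro hermitian_pos_def_row[OF \<Phi>]) simp
  qed
qed

section \<open>Matrix algebra and matrices of transfer functions\<close>

lemma matrix_diff_ldistrib: "A ** (B - C) = A ** B - A ** (C :: 'a::ring_1 ^ 'n ^ 'm)"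
  by (simp add: vec_eq_iff matrix_matrix_mult_def right_diff_distrib sum_subtractf)

lemma matrix_diff_rdistrib: "(B - C) ** A = B ** A - C ** (A :: 'a::ring_1 ^ 'n ^ 'm)"
  by (simp add: vec_eq_iff matrix_matrix_mult_def left_diff_distrib sum_subtractf)

lemma matrix_add_rdistrib: "(B + C) ** A = B ** A + C ** (A :: 'a::semiring_1 ^ 'n ^ 'm)"
  by (simp add: vec_eq_iff matrix_matrix_mult_def distrib_right sum.distrib)

lemma matrix_inv_left:
  fixes A :: "'a::semiring_1 ^ 'n ^ 'n"
  assumes "invertible A"
  shows "matrix_inv A ** A = mat 1"
  using assms unfolding invertible_def matrix_inv_def by (rule someI2_ex) simp

lemma invertible_if_row_kernel_trivial:
  fixes A :: "'a::field ^ 'n ^ 'n"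
  assumes "\<And>x. x v* A = 0 \<Longrightarrow> x = 0"
  shows "invertible A"
proof -
  have "\<exists>B. B ** transpose A = mat 1"
    unfolding matrix_left_invertible_ker using assms by simp
  then obtain B where "B ** transpose A = mat 1" ..
  then have "transpose (B ** transpose A) = mat 1" by simp
  then have "A ** transpose B = mat 1" by (simp add: matrix_transpose_mul)
  then show ?thesis unfolding invertible_right_inverse ..
qed

text \<open>The inverse is I + A (I - B A)^-1 B, also for rectangular \<open>A\<close> and
  \<open>B\<close>.\<close>

lemma invertible_mat_1_minus_swap:
  fixes A :: "'a::field ^ 'n ^ 'm" and B :: "'a ^ 'm ^ 'n"
  assumes "invertible (mat 1 - B ** A)"
  shows "invertible (mat 1 - A ** B)"
proof -
  define C where "C = matrix_inv (mat 1 - B ** A)"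
  have C: "C ** (mat 1 - B ** A) = mat 1"
    unfolding C_def by (rule matrix_inv_left[OF assms])
  have "(mat 1 + A ** C ** B) ** (mat 1 - A ** B) =
      mat 1 - A ** B + A ** (C ** (mat 1 - B ** A)) ** B"
    by (simp add: matrix_diff_ldistrib matrix_diff_rdistrib matrix_add_rdistrib matrix_mul_assoc)
  also have "\<dots> = mat 1" by (simp add: C)
  finally show ?thesis unfolding invertible_left_inverse by blast
qed

definition tfm_eval :: "tf ^ 'n ^ 'm \<Rightarrow> complex \<Rightarrow> complex ^ 'n ^ 'm" where
  "tfm_eval A z = (\<chi> i j. tf_eval (A $ i $ j) z)"

lemma tfm_eval_mult:
  assumes "entries_in tf_F A" "entries_in tf_F B" "cmod z = 1"
  shows "tfm_eval (A ** B) z = tfm_eval A z ** tfm_eval B z"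
  using assms by (simp add: tfm_eval_def vec_eq_iff matrix_matrix_mult_def entries_in_def tf_F_def)

lemma tfm_eval_diff:
  assumes "entries_in tf_F A" "entries_in tf_F B" "cmod z = 1"
  shows "tfm_eval (A - B) z = tfm_eval A z - tfm_eval B z"
  using assms by (simp add: tfm_eval_def vec_eq_iff entries_in_def tf_F_def)

lemma tfm_eval_mat_1 [simp]: "tfm_eval (mat 1) z = mat 1"
  by (simp add: tfm_eval_def vec_eq_iff mat_def)

lemma tfm_eval_submat: "tfm_eval (submat f g A) z = submat f g (tfm_eval A z)"
  by (simp add: tfm_eval_def submat_def vec_eq_iff)

lemma entries_in_tf_F:
  "entries_in tf_F A \<Longrightarrow> entries_in tf_F B \<Longrightarrow> entries_in tf_F (A ** B)"
  "entries_in tf_F C \<Longrightarrow> entries_in tf_F D \<Longrightarrow> entries_in tf_F (C - D)"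
  "entries_in tf_F (mat 1)"
  "entries_in S E \<Longrightarrow> entries_in S (submat f g E)"
  by (auto simp: entries_in_def matrix_matrix_mult_def submat_def mat_def intro!: tf_F_closed)

lemma tfm_eqI:
  assumes "entries_in tf_F A" "entries_in tf_F B" "\<And>z. cmod z = 1 \<Longrightarrow> tfm_eval A z = tfm_eval B z"
  shows "A = B"
  using assms by (auto simp: vec_eq_iff entries_in_def tfm_eval_def intro!: tf_F_eqI)

text \<open>A kernel row over the field of rational functions may have poles on the circle. Away
  from these finitely many points its values lie in the trivial kernel, and infinitely many points
  remain.\<close>

lemma invertible_tfmI:
  fixes A :: "tf ^ 'n::finite ^ 'n"
  assumes A: "entries_in tf_F A" and ker: "\<And>z x. cmod z = 1 \<Longrightarrow> x v* tfm_eval A z = 0 \<Longrightarrow> x = 0"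
  shows "invertible A"
proof (rule invertible_if_row_kernel_trivial)
  fix x :: "tf ^ 'n" assume x: "x v* A = 0"
  define Z where "Z = {z. cmod z = 1} - (\<Union>i. {z. tf_den (x $ i) z = 0})"
  have Z: "infinite Z"
    unfolding Z_def using infinite_unit_circle finite_tf_poles by (intro Diff_infinite_finite) auto
  have "tf_eval (x $ i) z = 0" if z: "z \<in> Z" for z i
  proof -
    have c: "cmod z = 1" and d: "tf_den (x $ j) z \<noteq> 0" for j using z by (auto simp: Z_def)
    have "tf_eval ((x v* A) $ j) z = ((\<chi> i. tf_eval (x $ i) z) v* tfm_eval A z) $ j" for j
      using A c d by (simp add: vector_matrix_mult_def tfm_eval_def entries_in_def tf_F_def)
    then have "(\<chi> i. tf_eval (x $ i) z) v* tfm_eval A z = 0"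
      using x by (simp add: vec_eq_iff)
    from ker[OF c this] show ?thesis by (simp add: vec_eq_iff)
  qed
  then have "Z \<subseteq> {z. tf_den (x $ i) z \<noteq> 0 \<and> tf_eval (x $ i) z = 0}" for i
    by (auto simp: Z_def)
  then have "x $ i = 0" for i
    by (intro tf_eq_0I) (metis Z infinite_super)
  then show "x = 0" by (simp add: vec_eq_iff)
qed

section \<open>The block identity for one node of the cycle\<close>

text \<open>\<rho> enumerates the coordinates of the estimated node \<alpha> and \<sigma> the
  regressors; among the latter, \<kappa> picks the child \<beta>, and \<iota> picks coordinates of a
  block \<pi> without an edge to \<beta>, in the application the parent of \<alpha> on the
  cycle.\<close>

lemma wiener_block_at:
  fixes q :: "complex ^ 'c::finite ^ 'c" and W :: "complex ^ 'b::finite ^ 'a::finite"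
    and \<iota> :: "'p::finite \<Rightarrow> 'b" and \<kappa> :: "'h::finite \<Rightarrow> 'b"
  assumes \<Phi>: "hermitian_pos_def \<Phi>" and R: "(mat 1 - q) ** R = mat 1"
    and diag: "\<And>a b. nd a \<noteq> nd b \<Longrightarrow> ((mat 1 - q) ** \<Phi> ** hadj (mat 1 - q)) $ a $ b = 0"
    and edges: "\<And>c d. (nd d, nd c) \<notin> E \<Longrightarrow> q $ c $ d = 0"
    and loops: "(\<alpha>, \<alpha>) \<notin> E" "(\<beta>, \<beta>) \<notin> E" "(\<beta>, \<alpha>) \<notin> E"
    and child: "\<And>\<gamma>. (\<alpha>, \<gamma>) \<in> E \<Longrightarrow> \<gamma> = \<beta>" and "\<alpha> \<noteq> \<beta>"
    and \<pi>: "\<pi> \<noteq> \<alpha>" "\<pi> \<noteq> \<beta>" "(\<pi>, \<beta>) \<notin> E"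
    and \<rho>: "bij_betw \<rho> UNIV {d. nd d = \<alpha>}" and \<sigma>: "bij_betw \<sigma> UNIV {d. nd d \<noteq> \<alpha>}"
    and \<iota>: "\<And>p. nd (\<sigma> (\<iota> p)) = \<pi>" and \<kappa>: "bij_betw (\<sigma> \<circ> \<kappa>) UNIV {d. nd d = \<beta>}"
    and W: "\<And>i j. \<Phi> $ \<rho> i $ \<sigma> j = (\<Sum>c\<in>UNIV. W $ i $ c * \<Phi> $ \<sigma> c $ \<sigma> j)"
  defines "L \<equiv> mat 1 - submat id \<kappa> W ** submat (\<sigma> \<circ> \<kappa>) \<rho> q"
  shows "x v* submat id \<iota> W = (x v* L) v* submat \<rho> (\<sigma> \<circ> \<iota>) q"
    and "x v* L = 0 \<Longrightarrow> x = 0"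
proof -
  \<comment> \<open>The combination \<open>x\<close> of the estimation errors, written in the
    coordinates of the whole output.\<close>
  define v where "v = (\<chi> c. if nd c = \<alpha> then x $ (inv \<rho> c) else - (x v* W) $ (inv \<sigma> c))"
  have nd\<rho>: "nd (\<rho> i) = \<alpha>" for i using \<rho> by (auto simp: bij_betw_def)
  have nd\<sigma>: "nd (\<sigma> j) \<noteq> \<alpha>" for j using \<sigma> by (auto simp: bij_betw_def)
  have v\<rho>: "v $ \<rho> i = x $ i" for i
    using \<rho> nd\<rho> by (simp add: v_def bij_betw_def)
  have v\<sigma>: "v $ \<sigma> j = - (x v* W) $ j" for j
    using \<sigma> nd\<sigma> by (simp add: v_def bij_betw_def)
  have v\<Phi>: "(v v* \<Phi>) $ c = 0" if c: "nd c \<noteq> \<alpha>" for c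
  proof -
    obtain j where j: "c = \<sigma> j" using \<sigma> c by (auto simp: bij_betw_def)
    have "(v v* \<Phi>) $ c = (\<Sum>d\<in>{d. nd d = \<alpha>} \<union> {d. nd d \<noteq> \<alpha>}. v $ d * \<Phi> $ d $ c)"
      by (simp add: vector_matrix_mult_def Un_def mult.commute)
    also have "\<dots> = (\<Sum>d | nd d = \<alpha>. v $ d * \<Phi> $ d $ c) + (\<Sum>d | nd d \<noteq> \<alpha>. v $ d * \<Phi> $ d $ c)"
      by (intro sum.union_disjoint) auto
    also have "\<dots> = (\<Sum>i\<in>UNIV. v $ \<rho> i * \<Phi> $ \<rho> i $ c) + (\<Sum>l\<in>UNIV. v $ \<sigma> l * \<Phi> $ \<sigma> l $ c)"
      by (simp only: sum.reindex_bij_betw[OF \<rho>, symmetric] sum.reindex_bij_betw[OF \<sigma>, symmetric])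
    also have "\<dots> = (\<Sum>i\<in>UNIV. x $ i * (\<Sum>l\<in>UNIV. W $ i $ l * \<Phi> $ \<sigma> l $ \<sigma> j)) -
        (\<Sum>l\<in>UNIV. (\<Sum>i\<in>UNIV. x $ i * W $ i $ l) * \<Phi> $ \<sigma> l $ \<sigma> j)"
      by (simp add: v\<rho> v\<sigma> j W[symmetric] vector_matrix_mult_def sum_negf mult.commute)
    also have "(\<Sum>l\<in>UNIV. (\<Sum>i\<in>UNIV. x $ i * W $ i $ l) * \<Phi> $ \<sigma> l $ \<sigma> j) =
        (\<Sum>l\<in>UNIV. \<Sum>i\<in>UNIV. x $ i * (W $ i $ l * \<Phi> $ \<sigma> l $ \<sigma> j))"
      by (simp add: sum_distrib_right mult.assoc)
    also have "\<dots> = (\<Sum>i\<in>UNIV. \<Sum>l\<in>UNIV. x $ i * (W $ i $ l * \<Phi> $ \<sigma> l $ \<sigma> j))"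
      by (rule sum.swap)
    finally show ?thesis by (simp add: sum_distrib_left)
  qed
  note rs = row_supported_on_block[where nd = nd, OF \<Phi> R diag edges loops child \<open>\<alpha> \<noteq> \<beta>\<close> v\<Phi>]
  define w where "w d = v $ d + (\<Sum>h | nd h = \<beta>. v $ h * q $ h $ d)" for d
  \<comment> \<open>The origin of \<open>L\<close>: on \<alpha>, the coefficients of
    \<open>v\<close> with respect to the rows of \<open>mat 1 - q\<close> are
    \<open>x v* L\<close>.\<close>
  have xL: "(x v* L) $ i = w (\<rho> i)" for i
  proof -
    have "(\<Sum>h | nd h = \<beta>. v $ h * q $ h $ \<rho> i) = (\<Sum>h\<in>UNIV. v $ \<sigma> (\<kappa> h) * q $ \<sigma> (\<kappa> h) $ \<rho> i)"
      by (simp add: sum.reindex_bij_betw[OF \<kappa>, symmetric])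
    also have "\<dots> = - ((x v* submat id \<kappa> W) v* submat (\<sigma> \<circ> \<kappa>) \<rho> q) $ i"
      by (simp add: v\<sigma> submat_def vector_matrix_mult_def sum_negf mult.commute)
    finally show ?thesis
      by (simp add: w_def v\<rho> L_def vector_matrix_mult_diff_rdistrib vector_matrix_mul_assoc)
  qed
  have "(x v* submat id \<iota> W) $ p = ((x v* L) v* submat \<rho> (\<sigma> \<circ> \<iota>) q) $ p" for p
  proof -
    have "(x v* submat id \<iota> W) $ p = - v $ \<sigma> (\<iota> p)"
      by (simp add: v\<sigma> submat_def vector_matrix_mult_def)
    also have "\<dots> = (\<Sum>d | nd d = \<alpha>. w d * q $ d $ \<sigma> (\<iota> p))"
    proof -
      have "v $ \<sigma> (\<iota> p) = - (\<Sum>d | nd d = \<alpha>. w d * q $ d $ \<sigma> (\<iota> p))"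
        unfolding w_def by (rule rs(1)[where \<pi> = \<pi>]) (use \<iota> \<pi> in auto)
      then show ?thesis by simp
    qed
    also have "\<dots> = (\<Sum>i\<in>UNIV. w (\<rho> i) * q $ \<rho> i $ \<sigma> (\<iota> p))"
      by (simp only: sum.reindex_bij_betw[OF \<rho>, symmetric])
    also have "\<dots> = ((x v* L) v* submat \<rho> (\<sigma> \<circ> \<iota>) q) $ p"
      by (simp add: submat_def vector_matrix_mult_def[of "x v* L"] xL mult.commute)
    finally show ?thesis .
  qed
  then show "x v* submat id \<iota> W = (x v* L) v* submat \<rho> (\<sigma> \<circ> \<iota>) q" by (simp add: vec_eq_iff)
  show "x = 0" if "x v* L = 0"
  proof -
    have w0: "w d = 0" if "nd d = \<alpha>" for d
    proof -
      have "d \<in> range \<rho>" using \<rho> that by (simp add: bij_betw_def)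
      then obtain i where "d = \<rho> i" by blast
      then show ?thesis using xL[of i] \<open>x v* L = 0\<close> by simp
    qed
    have "v = 0" by (rule rs(2)) (use w0 in \<open>auto simp: w_def\<close>)
    then show ?thesis using v\<rho> by (simp add: vec_eq_iff)
  qed
qed

lemma well_posed_inverse:
  fixes Q :: "tf ^ 'c::finite ^ 'c"
  assumes "well_posed nd Q"
  obtains R where "entries_in tf_F R" "(mat 1 - Q) ** R = mat 1"
proof -
  obtain R :: "'c \<Rightarrow> 'c \<Rightarrow> tf" where R: "R a b \<in> tf_F"
    "(\<Sum>c\<in>UNIV. (mat 1 - Q) $ a $ c * R c b) = (if a = b then 1 else 0)" for a b
    using assms[unfolded well_posed_def, rule_format, of UNIV] by auto
  show ?thesis
  proof (rule that[of "\<chi> a b. R a b"])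
    show "entries_in tf_F (\<chi> a b. R a b)" using R(1) by (simp add: entries_in_def)
    show "(mat 1 - Q) ** (\<chi> a b. R a b) = mat 1"
      unfolding matrix_matrix_mult_def using R(2) by (simp add: vec_eq_iff mat_def)
  qed
qed

text \<open>The result at single points is lifted: equality by agreement on the circle,
  invertibility of \<open>L\<close> over the rational functions because its values there have
  trivial row kernel.\<close>

lemma wiener_block:
  fixes Q :: "tf ^ 'c::finite ^ 'c" and W :: "tf ^ 'b::finite ^ 'a::finite"
    and \<iota> :: "'p::finite \<Rightarrow> 'b" and \<kappa> :: "'h::finite \<Rightarrow> 'b"
  assumes ldim: "ldim M nd Q nu P u e" and wp: "well_posed nd Q" and out: "ldim_output M Q e y"
    and graph: "graphical_representation nd Q E" and psd: "has_psd M y \<Phi>"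
    and pos: "\<And>z. cmod z = 1 \<Longrightarrow> hermitian_pos_def (\<Phi> z)"
    and loops: "(\<alpha>, \<alpha>) \<notin> E" "(\<beta>, \<beta>) \<notin> E" "(\<beta>, \<alpha>) \<notin> E"
    and child: "\<And>\<gamma>. (\<alpha>, \<gamma>) \<in> E \<Longrightarrow> \<gamma> = \<beta>" and "\<alpha> \<noteq> \<beta>"
    and \<pi>: "\<pi> \<noteq> \<alpha>" "\<pi> \<noteq> \<beta>" "(\<pi>, \<beta>) \<notin> E"
    and \<rho>: "bij_betw \<rho> UNIV {d. nd d = \<alpha>}" and \<sigma>: "bij_betw \<sigma> UNIV {d. nd d \<noteq> \<alpha>}"
    and \<iota>: "\<And>p. nd (\<sigma> (\<iota> p)) = \<pi>" and \<kappa>: "bij_betw (\<sigma> \<circ> \<kappa>) UNIV {d. nd d = \<beta>}"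
    and x: "\<And>t \<omega> a. x t \<omega> $ a = y t \<omega> $ \<rho> a" and x': "\<And>t \<omega> b. x' t \<omega> $ b = y t \<omega> $ \<sigma> b"
    and W: "wiener_filter M x x' W"
  defines "L \<equiv> mat 1 - submat id \<kappa> W ** submat (\<sigma> \<circ> \<kappa>) \<rho> Q"
  shows "invertible L" "submat id \<iota> W = L ** submat \<rho> (\<sigma> \<circ> \<iota>) Q"
proof -
  interpret prob_space M using ldim by (simp add: ldim_def)
  have y: "zero_mean_wss M y" using out by (simp add: ldim_output_def)
  have Q: "entries_in tf_F Q" using ldim by (simp add: ldim_def)
  have WF: "entries_in tf_F W" using W by (simp add: wiener_filter_def)
  have L: "entries_in tf_F L" unfolding L_def by (intro entries_in_tf_F Q WF)
  obtain R where R: "entries_in tf_F R" "(mat 1 - Q) ** R = mat 1"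
    using well_posed_inverse[OF wp] .
  have at: "z1 v* submat id \<iota> (tfm_eval W z) = (z1 v* tfm_eval L z) v* submat \<rho> (\<sigma> \<circ> \<iota>) (tfm_eval Q z)"
    "z1 v* tfm_eval L z = 0 \<Longrightarrow> z1 = 0" if z: "cmod z = 1" for z z1
  proof -
    have "(mat 1 - tfm_eval Q z) ** tfm_eval R z = tfm_eval ((mat 1 - Q) ** R) z"
      by (simp add: tfm_eval_mult tfm_eval_diff entries_in_tf_F Q R(1) z)
    then have R': "(mat 1 - tfm_eval Q z) ** tfm_eval R z = mat 1" by (simp add: R(2))
    have diag: "((mat 1 - tfm_eval Q z) ** \<Phi> z ** hadj (mat 1 - tfm_eval Q z)) $ a $ b = 0" if "nd a \<noteq> nd b" for a b
      using ldim_psd_off_diagonal[OF ldim out psd that z] by (simp add: tfm_eval_def)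
    have edges: "tfm_eval Q z $ c $ d = 0" if "(nd d, nd c) \<notin> E" for c d
      using graph that by (simp add: graphical_representation_def tfm_eval_def)
    have WP: "\<Phi> z $ \<rho> i $ \<sigma> j = (\<Sum>c\<in>UNIV. tfm_eval W z $ i $ c * \<Phi> z $ \<sigma> c $ \<sigma> j)" for i j
      using wiener_filter_psd[OF y psd x x' W z] by (simp add: tfm_eval_def)
    have "tfm_eval L z = mat 1 - submat id \<kappa> (tfm_eval W z) ** submat (\<sigma> \<circ> \<kappa>) \<rho> (tfm_eval Q z)"
      by (simp add: L_def tfm_eval_mult tfm_eval_diff entries_in_tf_F Q WF z tfm_eval_submat)
    with wiener_block_at[where nd = nd, OF pos[OF z] R' diag edges loops child \<open>\<alpha> \<noteq> \<beta>\<close> \<pi> \<rho> \<sigma> \<iota> \<kappa> WP]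
    show "z1 v* submat id \<iota> (tfm_eval W z) = (z1 v* tfm_eval L z) v* submat \<rho> (\<sigma> \<circ> \<iota>) (tfm_eval Q z)"
      "z1 v* tfm_eval L z = 0 \<Longrightarrow> z1 = 0"
      by simp_all
  qed
  show "invertible L" by (rule invertible_tfmI[OF L at(2)])
  show "submat id \<iota> W = L ** submat \<rho> (\<sigma> \<circ> \<iota>) Q"
  proof (rule tfm_eqI)
    fix z :: complex assume z: "cmod z = 1"
    have rows: "A = B" if "\<And>x. x v* A = x v* B" for A B :: "complex ^ 'p ^ 'a"
    proof -
      have "transpose A *v x = transpose B *v x" for x using that by simp
      then have "transpose A = transpose B" by (subst matrix_eq) blast
      then show ?thesis by simp
    qed
    have "tfm_eval (submat id \<iota> W) z = tfm_eval L z ** submat \<rho> (\<sigma> \<circ> \<iota>) (tfm_eval Q z)"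
      by (rule rows) (simp add: tfm_eval_submat at(1)[OF z] vector_matrix_mul_assoc)
    then show "tfm_eval (submat id \<iota> W) z = tfm_eval (L ** submat \<rho> (\<sigma> \<circ> \<iota>) Q) z"
      by (simp add: tfm_eval_mult entries_in_tf_F L Q z tfm_eval_submat)
  qed (intro entries_in_tf_F L Q WF)+
qed

section \<open>The revolving door\<close>

lemma revolving_door_algebra:
  fixes Qji :: "'a::field ^ 'i ^ 'j" and Qkj :: "'a ^ 'j ^ 'k" and Qik :: "'a ^ 'k ^ 'i"
  assumes inv: "invertible (mat 1 - Wij ** Qji)" "invertible (mat 1 - Wjk ** Qkj)" "invertible (mat 1 - Wki ** Qik)"
    and Wik: "Wik = (mat 1 - Wij ** Qji) ** Qik"
    and Wji: "Wji = (mat 1 - Wjk ** Qkj) ** Qji"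
    and Wkj: "Wkj = (mat 1 - Wki ** Qik) ** Qkj"
  defines "N \<equiv> mat 1 - Wij ** Qji - Wik ** Wki"
  defines "D \<equiv> mat 1 - Wjk ** Wkj - Wjk ** Wki ** matrix_inv N ** Wik ** Wkj"
  shows "invertible N" "invertible D" "Qji = matrix_inv D ** Wji"
proof -
  define Li where "Li = mat 1 - Wij ** Qji"
  \<comment> \<open>The formula for \<open>Wik\<close> lets \<open>Li\<close> be factored out on the
    left.\<close>
  have N: "N = Li ** (mat 1 - Qik ** Wki)"
    by (simp add: N_def Wik Li_def matrix_diff_ldistrib matrix_mul_assoc)
  show "invertible N"
    unfolding N using inv invertible_mat_1_minus_swap[OF inv(3)] by (simp add: invertible_mult Li_def)
  \<comment> \<open>The push-through identity (I - Qik Wki) Qik = Qik (I - Wki Qik) moves the second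
    factor of \<open>N\<close> next to \<open>Qkj\<close>, where it completes
    \<open>Wkj\<close>.\<close>
  have "N ** (Qik ** Qkj) = Li ** Qik ** ((mat 1 - Wki ** Qik) ** Qkj)"
    by (simp add: N matrix_diff_ldistrib matrix_diff_rdistrib matrix_mul_assoc)
  also have "\<dots> = Wik ** Wkj" by (simp only: Wik Wkj Li_def)
  finally have "matrix_inv N ** (N ** (Qik ** Qkj)) = matrix_inv N ** (Wik ** Wkj)" by simp
  then have X: "matrix_inv N ** Wik ** Wkj = Qik ** Qkj"
    using matrix_inv_left[OF \<open>invertible N\<close>] by (simp add: matrix_mul_assoc)
  have "Wjk ** Wki ** matrix_inv N ** Wik ** Wkj = Wjk ** Wki ** (matrix_inv N ** Wik ** Wkj)"
    by (simp add: matrix_mul_assoc)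
  then have "D = mat 1 - Wjk ** Wkj - Wjk ** Wki ** (Qik ** Qkj)"
    by (simp only: D_def X)
  \<comment> \<open>The formula for \<open>Wkj\<close> gives Wkj + Wki Qik Qkj = Qkj, so the two
    correction terms merge into one.\<close>
  then have D: "D = mat 1 - Wjk ** Qkj"
    by (simp add: Wkj matrix_diff_ldistrib matrix_diff_rdistrib matrix_mul_assoc)
  then show "invertible D" using inv by simp
  have "matrix_inv D ** Wji = matrix_inv D ** D ** Qji"
    by (simp add: Wji D matrix_mul_assoc)
  then show "Qji = matrix_inv D ** Wji"
    by (simp add: matrix_inv_left[OF \<open>invertible D\<close>])
qed

section \<open>Coordinates of the four nodes\<close>

lemma node_of_simps [simp]:
  "node_of (Inl i) = Ni" "node_of (Inr (Inl j)) = Nj"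
  "node_of (Inr (Inr (Inl k))) = Nk" "node_of (Inr (Inr (Inr s))) = Ns"
  by (simp_all add: node_of_def)

lemma node_cases:
  obtains i where "d = Inl i" | j where "d = Inr (Inl j)" | k where "d = Inr (Inr (Inl k))"
  | s where "d = Inr (Inr (Inr s))"
  by (metis sum.exhaust)

lemma bij_betw_UNIV_Collect: "inj f \<Longrightarrow> (\<And>d. d \<in> range f \<longleftrightarrow> P d) \<Longrightarrow> bij_betw f UNIV {d. P d}"
  by (auto simp: bij_betw_def)

lemma range_case_sum: "range (case_sum f g) = range f \<union> range g"
  by (simp add: UNIV_sum image_Un image_image)

lemma bij_betw_node_of:
  "bij_betw Inl UNIV {d. node_of d = Ni}"
  "bij_betw (Inr \<circ> Inl) UNIV {d. node_of d = Nj}"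
  "bij_betw (Inr \<circ> Inr \<circ> Inl) UNIV {d. node_of d = Nk}"
proof (goal_cases)
  case 1
  show ?case
  proof (rule bij_betw_UNIV_Collect)
    show "d \<in> range Inl \<longleftrightarrow> node_of d = Ni" for d
      by (cases d rule: node_cases) auto
  qed (simp add: inj_def)
next
  case 2
  show ?case
  proof (rule bij_betw_UNIV_Collect)
    show "d \<in> range (Inr \<circ> Inl) \<longleftrightarrow> node_of d = Nj" for d
      by (cases d rule: node_cases) auto
  qed (simp add: inj_def)
next
  case 3
  show ?case
  proof (rule bij_betw_UNIV_Collect)
    show "d \<in> range (Inr \<circ> Inr \<circ> Inl) \<longleftrightarrow> node_of d = Nk" for d
      by (cases d rule: node_cases) auto
  qed (simp add: inj_def)
qed

text \<open>In each stacked regressor the predecessor on the cycle comes first, the successor second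
  and the source last, so \<open>first\<close> and \<open>second\<close> select the blocks \<pi> and
  \<beta> uniformly.\<close>

lemma bij_betw_regressors:
  "bij_betw (case_sum Inl (case_sum (Inr \<circ> Inr \<circ> Inl) (Inr \<circ> Inr \<circ> Inr))) UNIV {d. node_of d \<noteq> Nj}"
  "bij_betw (case_sum (Inr \<circ> Inl) (case_sum Inl (Inr \<circ> Inr \<circ> Inr))) UNIV {d. node_of d \<noteq> Nk}"
  "bij_betw (case_sum (Inr \<circ> Inr \<circ> Inl) (case_sum (Inr \<circ> Inl) (Inr \<circ> Inr \<circ> Inr))) UNIV {d. node_of d \<noteq> Ni}"
proof (goal_cases)
  case 1
  show ?case
  proof (rule bij_betw_UNIV_Collect, unfold range_case_sum)
    show "d \<in> range Inl \<union> (range (Inr \<circ> Inr \<circ> Inl) \<union> range (Inr \<circ> Inr \<circ> Inr)) \<longleftrightarrow> node_of d \<noteq> Nj" for d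
      by (cases d rule: node_cases) auto
  qed (auto simp: inj_def split: sum.splits)
next
  case 2
  show ?case
  proof (rule bij_betw_UNIV_Collect, unfold range_case_sum)
    show "d \<in> range (Inr \<circ> Inl) \<union> (range Inl \<union> range (Inr \<circ> Inr \<circ> Inr)) \<longleftrightarrow> node_of d \<noteq> Nk" for d
      by (cases d rule: node_cases) auto
  qed (auto simp: inj_def split: sum.splits)
next
  case 3
  show ?case
  proof (rule bij_betw_UNIV_Collect, unfold range_case_sum)
    show "d \<in> range (Inr \<circ> Inr \<circ> Inl) \<union> (range (Inr \<circ> Inl) \<union> range (Inr \<circ> Inr \<circ> Inr)) \<longleftrightarrow> node_of d \<noteq> Ni" for d
      by (cases d rule: node_cases) auto
  qed (auto simp: inj_def split: sum.splits)
qed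

text \<open>\<open>matrix_inv\<close> has no specified value at a singular matrix; the formula
  therefore comes with the invertibility of both matrices, over the field of rational
  functions.\<close>

theorem theorem27:
  fixes M :: "'w measure"
    and Q :: "tf ^ ('i::finite + 'j::finite + 'k::finite + 's::finite) ^ ('i + 'j + 'k + 's)"
    and nu :: "'d::finite \<Rightarrow> node"
    and P :: "tf ^ 'd ^ ('i + 'j + 'k + 's)"
    and u :: "('w, 'd) process"
    and e :: "('w, 'i + 'j + 'k + 's) process"
    and yi :: "('w, 'i) process" and yj :: "('w, 'j) process"
    and yk :: "('w, 'k) process" and ys :: "('w, 's) process"
    and \<Phi> :: "complex \<Rightarrow> complex ^ ('i + 'j + 'k + 's) ^ ('i + 'j + 'k + 's)"
    and Wj :: "tf ^ ('i + 'k + 's) ^ 'j"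
    and Wk :: "tf ^ ('j + 'i + 's) ^ 'k"
    and Wi :: "tf ^ ('k + 'j + 's) ^ 'i"
  assumes "ldim M node_of Q nu P u e"
    and "well_posed node_of Q"
    and "ldim_output M Q e (yi \<oplus> yj \<oplus> yk \<oplus> ys)"
    and "graphical_representation node_of Q revolving_door"
    and "has_psd M (yi \<oplus> yj \<oplus> yk \<oplus> ys) \<Phi>"
    and "\<And>z. cmod z = 1 \<Longrightarrow> hermitian_pos_def (\<Phi> z)"
    and "wiener_filter M yj (yi \<oplus> yk \<oplus> ys) Wj"
    and "wiener_filter M yk (yj \<oplus> yi \<oplus> ys) Wk"
    and "wiener_filter M yi (yk \<oplus> yj \<oplus> ys) Wi"
  shows
    "let Qji = submat second first Q;
         Wji = submat id first Wj; Wjk = submat id second Wj;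
         Wkj = submat id first Wk; Wki = submat id second Wk;
         Wik = submat id first Wi; Wij = submat id second Wi;
         N = mat 1 - Wij ** Qji - Wik ** Wki;
         D = mat 1 - Wjk ** Wkj - Wjk ** Wki ** matrix_inv N ** Wik ** Wkj
     in invertible N \<and> invertible D \<and> Qji = matrix_inv D ** Wji"
proof -
  let ?y = "yi \<oplus> yj \<oplus> yk \<oplus> ys"
  let ?\<rho>i = "Inl :: 'i \<Rightarrow> 'i + 'j + 'k + 's"
  let ?\<rho>j = "(Inr \<circ> Inl) :: 'j \<Rightarrow> 'i + 'j + 'k + 's"
  let ?\<rho>k = "(Inr \<circ> Inr \<circ> Inl) :: 'k \<Rightarrow> 'i + 'j + 'k + 's"
  let ?\<rho>s = "(Inr \<circ> Inr \<circ> Inr) :: 's \<Rightarrow> 'i + 'j + 'k + 's"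
  let ?\<sigma>j = "case_sum ?\<rho>i (case_sum ?\<rho>k ?\<rho>s)"
  let ?\<sigma>k = "case_sum ?\<rho>j (case_sum ?\<rho>i ?\<rho>s)"
  let ?\<sigma>i = "case_sum ?\<rho>k (case_sum ?\<rho>j ?\<rho>s)"
  have comp: "?\<sigma>j \<circ> first = ?\<rho>i" "?\<sigma>j \<circ> second = ?\<rho>k" "?\<sigma>k \<circ> first = ?\<rho>j" "?\<sigma>k \<circ> second = ?\<rho>i"
    "?\<sigma>i \<circ> first = ?\<rho>k" "?\<sigma>i \<circ> second = ?\<rho>j"
    by auto
  have yj: "yj t \<omega> $ a = ?y t \<omega> $ ?\<rho>j a" "(yi \<oplus> yk \<oplus> ys) t \<omega> $ b = ?y t \<omega> $ ?\<sigma>j b" for t \<omega> a b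
    by (auto simp: stack_def split: sum.splits)
  have yk: "yk t \<omega> $ a = ?y t \<omega> $ ?\<rho>k a" "(yj \<oplus> yi \<oplus> ys) t \<omega> $ b = ?y t \<omega> $ ?\<sigma>k b" for t \<omega> a b
    by (auto simp: stack_def split: sum.splits)
  have yi: "yi t \<omega> $ a = ?y t \<omega> $ ?\<rho>i a" "(yk \<oplus> yj \<oplus> ys) t \<omega> $ b = ?y t \<omega> $ ?\<sigma>i b" for t \<omega> a b
    by (auto simp: stack_def split: sum.splits)
  note block = wiener_block[OF assms(1-3) assms(4) assms(5,6)]
  \<comment> \<open>For each node of the cycle, the successor is its single child, and the
    predecessor has no edge to that child, unlike the source \<open>Ns\<close>. The edge conditions
    of the block identity thus hold in all three rotations.\<close>
  have j: "invertible (mat 1 - submat id second Wj ** submat ?\<rho>k ?\<rho>j Q)"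
      "submat id first Wj = (mat 1 - submat id second Wj ** submat ?\<rho>k ?\<rho>j Q) ** submat ?\<rho>j ?\<rho>i Q"
    using block[where \<alpha> = Nj and \<beta> = Nk and \<pi> = Ni and \<iota> = first and \<kappa> = second and \<sigma> = ?\<sigma>j and \<rho> = ?\<rho>j
        and W = Wj and x = yj and x' = "yi \<oplus> yk \<oplus> ys", OF _ _ _ _ _ _ _ _ _ bij_betw_node_of(2) bij_betw_regressors(1) _ _ yj assms(7)]
      bij_betw_node_of
    unfolding comp by (simp_all add: revolving_door_def node_of_def)
  have k: "invertible (mat 1 - submat id second Wk ** submat ?\<rho>i ?\<rho>k Q)"
      "submat id first Wk = (mat 1 - submat id second Wk ** submat ?\<rho>i ?\<rho>k Q) ** submat ?\<rho>k ?\<rho>j Q"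
    using block[where \<alpha> = Nk and \<beta> = Ni and \<pi> = Nj and \<iota> = first and \<kappa> = second and \<sigma> = ?\<sigma>k and \<rho> = ?\<rho>k
        and W = Wk and x = yk and x' = "yj \<oplus> yi \<oplus> ys", OF _ _ _ _ _ _ _ _ _ bij_betw_node_of(3) bij_betw_regressors(2) _ _ yk assms(8)]
      bij_betw_node_of
    unfolding comp by (simp_all add: revolving_door_def node_of_def)
  have i: "invertible (mat 1 - submat id second Wi ** submat ?\<rho>j ?\<rho>i Q)"
      "submat id first Wi = (mat 1 - submat id second Wi ** submat ?\<rho>j ?\<rho>i Q) ** submat ?\<rho>i ?\<rho>k Q"
    using block[where \<alpha> = Ni and \<beta> = Nj and \<pi> = Nk and \<iota> = first and \<kappa> = second and \<sigma> = ?\<sigma>i and \<rho> = ?\<rho>i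
        and W = Wi and x = yi and x' = "yk \<oplus> yj \<oplus> ys", OF _ _ _ _ _ _ _ _ _ bij_betw_node_of(1) bij_betw_regressors(3) _ _ yi assms(9)]
      bij_betw_node_of
    unfolding comp by (simp_all add: revolving_door_def node_of_def)
  have Qji: "submat second first Q = submat ?\<rho>j ?\<rho>i Q" by (simp add: submat_def)
  show ?thesis
    unfolding Let_def Qji
    using revolving_door_algebra[OF i(1) j(1) k(1) i(2) j(2) k(2)] by blast
qed

end
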